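(* Let $f:\mathbb{R}^d\to\mathbb{R}$ be $L$-smooth ($L>0$) and bounded below. Let $(\sigma_n)_{n\ge1}$ be positive reals, $N\ge1$ an integer, $0<t<\frac{1}{2L(d+4)}$, and $\mathbf{x}_0\in\mathbb{R}^d$ deterministic. For $\sigma>0$, $\mathbf{x},\mathbf{u}\in\mathbb{R}^d$ let $\delta_\sigma(\mathbf{x};\mathbf{u})$ be either (one fixed choice throughout) $\frac{f(\mathbf{x}+\sigma\mathbf{u})-f(\mathbf{x})}{\sigma/2}$ or $\frac{f(\mathbf{x}+\sigma\mathbf{u})-f(\mathbf{x}-\sigma\mathbf{u})}{\sigma}$, and let $\mathbf{g}_\sigma(\mathbf{x};N)=\frac1N\sum_{n=1}^N\delta_\sigma(\mathbf{x};\mathbf{u}_n)\mathbf{u}_n$, where $\mathbf{u}_1,\dots,\mathbf{u}_N$ are i.i.d. with density $\pi^{-d/2}e^{-\|\mathbf{u}\|^2}$ (i.e. $\mathcal N(0,\tfrac12 I_d)$). Define $\mathbf{x}_{k+1}=\mathbf{x}_k-t\,\mathbf{g}_{\sigma_{k+1}}(\mathbf{x}_k;N)$, using fresh independent samples at each step. Then for every $k\ge1$, $$\min_{i=0,\dots,k-1}\mathbb{E}\|\nabla f(\mathbf{x}_i)\|^2\le \frac1k\cdot\frac{N}{N-2Lt(d+4)}\left(\frac{4\big(f(\mathbf{x}_0)-\mathbb{E} f_{\sigma_k}(\mathbf{x}_k)\big)}{t}+\Big(\frac{L^3t(d+6)^3}{4N}+\frac{2Ld}{t}\Big)\sum_{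i=1}^k\sigma_i^2\right).$$
   Context: For a measurable $f:\mathbb{R}^d\to\mathbb{R}$ and $\sigma>0$, the Gaussian smoothing of $f$ with radius $\sigma$ is $f_\sigma(\mathbf{x})=\pi^{-d/2}\int_{\mathbb{R}^d} f(\mathbf{x}+\sigma\mathbf{u})\,e^{-\|\mathbf{u}\|_2^2}\,d\mathbf{u}$, and $f_0=f$. A function is $L$-smooth if it is differentiable and its gradient is $L$-Lipschitz in the Euclidean norm. Expectations are over all random samples. *)

theory Defs
  imports "HOL-Probability.Probability"
begin

definition grad :: "('a::euclidean_space \<Rightarrow> real) \<Rightarrow> 'a \<Rightarrow> 'a" where
  "grad f x = (SOME g. (f has_derivative (\<lambda>h. g \<bullet> h)) (at x))"

definition L_smooth :: "('a::euclidean_space \<Rightarrow> real) \<Rightarrow> real \<Rightarrow> bool" where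
  "L_smooth f L \<longleftrightarrow> (\<forall>x. f differentiable (at x)) \<and>
     (\<forall>x y. norm (grad f x - grad f y) \<le> L * norm (x - y))"

definition gsmooth :: "('a::euclidean_space \<Rightarrow> real) \<Rightarrow> real \<Rightarrow> 'a \<Rightarrow> real" where
  "gsmooth f \<sigma> x = (if \<sigma> = 0 then f x else
     pi powr (- real DIM('a) / 2) * (\<integral>u. f (x + \<sigma> *\<^sub>R u) * exp (- (norm u)\<^sup>2) \<partial>lborel))"

definition gauss :: "'a::euclidean_space measure" where
  "gauss = density lborel (\<lambda>u. ennreal (pi powr (- real DIM('a) / 2) * exp (- (norm u)\<^sup>2)))"

definition zo_delta :: "bool \<Rightarrow> ('a::euclidean_space \<Rightarrow> real) \<Rightarrow> real \<Rightarrow> 'a \<Rightarrow> 'a \<Rightarrow> real" where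
  "zo_delta fwd f \<sigma> x u = (if fwd then (f (x + \<sigma> *\<^sub>R u) - f x) / (\<sigma> / 2)
                             else (f (x + \<sigma> *\<^sub>R u) - f (x - \<sigma> *\<^sub>R u)) / \<sigma>)"

definition zo_grad :: "bool \<Rightarrow> ('a::euclidean_space \<Rightarrow> real) \<Rightarrow> real \<Rightarrow> nat \<Rightarrow> 'a \<Rightarrow> (nat \<Rightarrow> 'a) \<Rightarrow> 'a" where
  "zo_grad fwd f \<sigma> N x v = (1 / real N) *\<^sub>R (\<Sum>n = 1..N. zo_delta fwd f \<sigma> x (v n) *\<^sub>R v n)"

text \<open>Iterates x_k; u k n is the n-th sample used in step k+1 (i.e. to compute x_(k+1)).\<close>
primrec zo_iter :: "bool \<Rightarrow> ('a::euclidean_space \<Rightarrow> real) \<Rightarrow> (nat \<Rightarrow> real) \<Rightarrow> nat \<Rightarrow> real \<Rightarrow> 'a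
    \<Rightarrow> (nat \<Rightarrow> nat \<Rightarrow> 'a) \<Rightarrow> nat \<Rightarrow> 'a" where
  "zo_iter fwd f \<sigma> N t x0 u 0 = x0"
| "zo_iter fwd f \<sigma> N t x0 u (Suc k) =
     zo_iter fwd f \<sigma> N t x0 u k - t *\<^sub>R zo_grad fwd f (\<sigma> (Suc k)) N (zo_iter fwd f \<sigma> N t x0 u k) (u k)"

end

theory Submission
  imports Defs
begin

text \<open>Descent is measured along \<open>f\<close> itself rather than along its smoothings, so that the smoothing
  error \<open>L d \<sigma>\<^sub>k\<^sup>2 / 4\<close> is paid only once, at the last iterate. With \<open>a\<close> the gradient of \<open>f\<close> at
  the current point and \<open>m\<close> the mean of the one-sample estimator \<open>h\<close>, averaging \<open>N\<close> independent samples gives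
  \<open>E \<parallel>g\<parallel>\<^sup>2 = E \<parallel>h\<parallel>\<^sup>2 / N + (1 - 1/N) \<parallel>m\<parallel>\<^sup>2\<close>. Taylor's formula and the Gaussian moments give
  \<open>E \<parallel>h\<parallel>\<^sup>2 \<le> 2 (d + 4) \<parallel>a\<parallel>\<^sup>2 + L\<^sup>2 \<sigma>\<^sup>2 (d + 6)\<^sup>3 / 4\<close> and \<open>\<parallel>m - a\<parallel>\<^sup>2 \<le> L\<^sup>2 \<sigma>\<^sup>2 d (d + 2) / 8\<close>. Writing
  \<open>2 a \<bullet> m = \<parallel>a\<parallel>\<^sup>2 + \<parallel>m\<parallel>\<^sup>2 - \<parallel>m - a\<parallel>\<^sup>2\<close>, the term \<open>\<parallel>m\<parallel>\<^sup>2\<close> absorbs the second part of \<open>E \<parallel>g\<parallel>\<^sup>2\<close>,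
  and the bound on \<open>t\<close> lets \<open>L d \<sigma>\<^sup>2 / t\<close> absorb the bias. Since \<open>f\<close> is bounded below, the expected
  decrease telescopes without any moment assumption on the iterates.\<close>

subsection \<open>Smooth functions\<close>

text \<open>\<open>grad\<close> is a Hilbert choice, so a vector representing the derivative has to
  be exhibited first. It is the Riesz vector, whose coordinate along each basis vector
  \<open>b\<close> is \<open>f' b\<close>.\<close>

lemma differentiable_has_derivative_grad:
  fixes f :: "'a::euclidean_space \<Rightarrow> real"
  assumes "f differentiable (at x)"
  shows "(f has_derivative (\<lambda>h. grad f x \<bullet> h)) (at x)"
proof -
  obtain f' where f': "(f has_derivative f') (at x)"
    using assms by (auto simp: differentiable_def)
  interpret linear f'
    using f' has_derivative_linear by blast
  have "f' h = (\<Sum>b\<in>Basis. f' b *\<^sub>R b) \<bullet> h" for h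
  proof -
    have "f' h = f' (\<Sum>b\<in>Basis. (h \<bullet> b) *\<^sub>R b)"
      by (simp add: euclidean_representation)
    also have "\<dots> = (\<Sum>b\<in>Basis. (h \<bullet> b) * f' b)"
      by (simp add: sum scale)
    also have "\<dots> = (\<Sum>b\<in>Basis. f' b *\<^sub>R b) \<bullet> h"
      by (simp add: inner_sum_left inner_commute[of h] mult.commute)
    finally show ?thesis .
  qed
  then have "f' = (\<lambda>h. (\<Sum>b\<in>Basis. f' b *\<^sub>R b) \<bullet> h)" ..
  with f' have "(f has_derivative (\<lambda>h. (\<Sum>b\<in>Basis. f' b *\<^sub>R b) \<bullet> h)) (at x)"
    by simp
  then show ?thesis
    unfolding grad_def by (rule someI)
qed

lemma L_smooth_has_derivative:
  assumes "L_smooth f L"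
  shows "(f has_derivative (\<lambda>h. grad f x \<bullet> h)) (at x)"
  using assms differentiable_has_derivative_grad by (auto simp: L_smooth_def)

lemma L_smooth_measurable:
  assumes "L_smooth f L"
  shows "f \<in> borel_measurable borel"
  by (intro borel_measurable_continuous_onI continuous_at_imp_continuous_on ballI
      has_derivative_continuous[OF L_smooth_has_derivative[OF assms]])

lemma L_smooth_grad_measurable:
  fixes f :: "'a::euclidean_space \<Rightarrow> real"
  assumes "L_smooth f L" "L > 0"
  shows "grad f \<in> borel_measurable borel"
proof (rule borel_measurable_continuous_onI)
  have "L-lipschitz_on UNIV (grad f)"
    using assms by (auto intro!: lipschitz_onI simp: L_smooth_def dist_norm)
  then show "continuous_on UNIV (grad f)"
    by (rule lipschitz_on_continuous_on)
qed

lemma L_smooth_taylor_upper: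
  fixes f :: "'a::euclidean_space \<Rightarrow> real"
  assumes "L_smooth f L"
  shows "f (x + h) - f x - grad f x \<bullet> h \<le> L / 2 * (norm h)\<^sup>2"
proof -
  \<comment> \<open>\<open>p\<close> is \<open>f\<close> along the segment minus its linear part and
    the quadratic allowance. Cauchy-Schwarz and the Lipschitz gradient make its derivative
    nonpositive on [0, 1], so \<open>p 1 \<le> p 0\<close>.\<close>
  define p where "p s = f (x + s *\<^sub>R h) - s * (grad f x \<bullet> h) - L / 2 * s\<^sup>2 * (norm h)\<^sup>2" for s
  have "p 0 \<ge> p 1"
  proof (rule DERIV_nonpos_imp_nonincreasing[of 0 1 p])
    fix s :: real assume s: "0 \<le> s" "s \<le> 1"
    let ?D = "grad f (x + s *\<^sub>R h) \<bullet> h - grad f x \<bullet> h - L * s * (norm h)\<^sup>2"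
    have "((\<lambda>s. x + s *\<^sub>R h) has_derivative (\<lambda>r. r *\<^sub>R h)) (at s)"
      by (auto intro!: derivative_eq_intros)
    from has_derivative_compose[OF this L_smooth_has_derivative[OF assms]]
    have d: "((\<lambda>s. f (x + s *\<^sub>R h)) has_real_derivative grad f (x + s *\<^sub>R h) \<bullet> h) (at s)"
      by (simp add: has_field_derivative_def mult.commute[of _ "grad _ _ \<bullet> _"])
    have "DERIV p s :> ?D"
      unfolding p_def by (auto intro!: derivative_eq_intros d)
    moreover have "?D \<le> 0"
    proof -
      have "grad f (x + s *\<^sub>R h) \<bullet> h - grad f x \<bullet> h = (grad f (x + s *\<^sub>R h) - grad f x) \<bullet> h"
        by (simp add: inner_diff_left)
      also have "\<dots> \<le> norm (grad f (x + s *\<^sub>R h) - grad f x) * norm h"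
        by (rule norm_cauchy_schwarz)
      also have "\<dots> \<le> (L * norm ((x + s *\<^sub>R h) - x)) * norm h"
        using assms unfolding L_smooth_def by (intro mult_right_mono norm_ge_zero) blast
      also have "\<dots> = L * s * (norm h)\<^sup>2"
        using s by (simp add: power2_eq_square)
      finally show "?D \<le> 0" by simp
    qed
    ultimately show "\<exists>y. DERIV p s :> y \<and> y \<le> 0" by blast
  qed simp
  then show ?thesis by (simp add: p_def)
qed

text \<open>Prepares the lower Taylor bound, which is the upper one for \<open>- f\<close>. As
  \<open>grad\<close> is a choice, the identity rests on uniqueness of the derivative.\<close>

lemma grad_uminus:
  fixes f :: "'a::euclidean_space \<Rightarrow> real"
  assumes "f differentiable (at x)"
  shows "grad (\<lambda>x. - f x) x = - grad f x"
proof -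
  have "((\<lambda>x. - f x) has_derivative (\<lambda>h. - (grad f x \<bullet> h))) (at x)"
    by (intro has_derivative_minus differentiable_has_derivative_grad assms)
  moreover have "((\<lambda>x. - f x) has_derivative (\<lambda>h. grad (\<lambda>x. - f x) x \<bullet> h)) (at x)"
    by (intro differentiable_has_derivative_grad differentiable_minus assms)
  ultimately have "(\<lambda>h. - (grad f x \<bullet> h)) = (\<lambda>h. grad (\<lambda>x. - f x) x \<bullet> h)"
    by (rule has_derivative_unique)
  then have "\<forall>h. (- grad f x) \<bullet> h = grad (\<lambda>x. - f x) x \<bullet> h"
    by (auto dest: fun_cong)
  then show ?thesis
    by (metis vector_eq_ldot inner_commute)
qed

lemma L_smooth_uminus:
  assumes "L_smooth f L"
  shows "L_smooth (\<lambda>x. - f x) L"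
  using assms by (auto simp: L_smooth_def grad_uminus norm_minus_commute intro: differentiable_minus)

lemma L_smooth_taylor:
  fixes f :: "'a::euclidean_space \<Rightarrow> real"
  assumes "L_smooth f L"
  shows "\<bar>f (x + h) - f x - grad f x \<bullet> h\<bar> \<le> L / 2 * (norm h)\<^sup>2"
proof -
  have e: "grad (\<lambda>x. - f x) x = - grad f x"
    using assms by (intro grad_uminus) (simp add: L_smooth_def)
  show ?thesis
    using L_smooth_taylor_upper[OF assms, of x h]
      L_smooth_taylor_upper[OF L_smooth_uminus[OF assms], of x h]
    unfolding e inner_minus_left by linarith
qed

subsection \<open>Gaussian moments\<close>

lemma sets_gauss [measurable_cong, simp]: "sets gauss = sets borel"
  and space_gauss [simp]: "space gauss = UNIV"
  by (auto simp: gauss_def)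

lemma norm_power2_eq_sum_Basis: "(norm u)\<^sup>2 = (\<Sum>b\<in>Basis. (u \<bullet> b)\<^sup>2)"
  by (subst power2_norm_eq_inner, subst euclidean_inner) (simp add: power2_eq_square)

lemma prob_space_gauss: "prob_space (gauss :: 'a::euclidean_space measure)"
proof
  have *: "(\<integral>\<^sup>+x. ennreal (exp (- x\<^sup>2) / sqrt pi) \<partial>lborel) = 1"
  proof -
    \<comment> \<open>Standard deviation \<open>1 / sqrt 2\<close>, that is variance 1/2, turns the
      normal density into \<open>exp (- x\<^sup>2) / sqrt pi\<close>, the one-dimensional factor of
      \<open>gauss\<close>.\<close>
    have "prob_space (density lborel (normal_density 0 (1 / sqrt 2)))"
      by (rule prob_space_normal_density) simp
    then have "emeasure (density lborel (normal_density 0 (1 / sqrt 2))) UNIV = 1"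
      using prob_space.emeasure_space_1 by force
    then show ?thesis
      by (simp add: emeasure_density normal_density_def power_divide)
  qed
  have "pi powr (- real DIM('a) / 2) * exp (- (norm u)\<^sup>2) = (\<Prod>b\<in>Basis. exp (- (u \<bullet> b)\<^sup>2) / sqrt pi)" for u :: 'a
  proof -
    have "pi powr (- real DIM('a) / 2) = (pi powr (-1/2)) powr real DIM('a)"
      by (simp add: powr_powr)
    also have "\<dots> = (1 / sqrt pi) ^ DIM('a)"
      by (subst powr_realpow) (simp_all add: powr_minus_divide powr_half_sqrt)
    finally show ?thesis
      by (simp add: norm_power2_eq_sum_Basis exp_sum sum_negf[symmetric] prod_dividef power_divide)
  qed
  then have "emeasure (gauss :: 'a measure) (space gauss) =
      (\<integral>\<^sup>+u. (\<Prod>b\<in>Basis. ennreal (exp (- (u \<bullet> b)\<^sup>2) / sqrt pi)) \<partial>(lborel :: 'a measure))"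
    by (simp add: gauss_def emeasure_density prod_ennreal)
  also have "\<dots> = (\<Prod>b\<in>(Basis :: 'a set). \<integral>\<^sup>+x. ennreal (exp (- x\<^sup>2) / sqrt pi) \<partial>lborel)"
    by (rule nn_integral_lborel_prod) auto
  finally show "emeasure (gauss :: 'a measure) (space gauss) = 1"
    using * by simp
qed

interpretation gauss: prob_space gauss
  by (rule prob_space_gauss)

section \<open>Diagonal changes of variables and the moments they determine\<close>

lemma has_bochner_integral_lborel_diagonal:
  fixes F :: "'a::euclidean_space \<Rightarrow> real" and c :: "'a \<Rightarrow> real"
  defines "T u \<equiv> \<Sum>j\<in>Basis. (c j * (u \<bullet> j)) *\<^sub>R j"
  assumes c: "\<And>j. j \<in> Basis \<Longrightarrow> c j \<noteq> 0" and F: "has_bochner_integral lborel F I"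
  shows "has_bochner_integral lborel (\<lambda>u. (\<Prod>j\<in>Basis. \<bar>c j\<bar>) * F (T u)) I"
proof -
  have [measurable]: "F \<in> borel_measurable borel"
    using F by (auto dest: borel_measurable_has_bochner_integral)
  have T [measurable]: "T \<in> borel_measurable borel"
    unfolding T_def by measurable
  have eq: "lborel = density (distr lborel borel T) (\<lambda>_. (\<Prod>j\<in>Basis. \<bar>c j\<bar>))"
    using lborel_affine_euclidean[of c 0] c by (simp add: T_def[abs_def])
  have "has_bochner_integral (density (distr lborel borel T) (\<lambda>_. (\<Prod>j\<in>Basis. \<bar>c j\<bar>))) F I"
    using F by (subst eq[symmetric])
  then show ?thesis
    by (simp add: has_bochner_integral_iff integrable_density integral_density
        integrable_distr_eq integral_distr prod_nonneg del: integrable_mult_left_iff)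
qed

lemma has_bochner_integral_gauss_iff:
  fixes F :: "'a::euclidean_space \<Rightarrow> real"
  assumes [measurable]: "F \<in> borel_measurable borel"
  shows "has_bochner_integral gauss F I \<longleftrightarrow>
    has_bochner_integral lborel (\<lambda>u. pi powr (- real DIM('a) / 2) * exp (- (norm u)\<^sup>2) * F u) I"
  by (simp add: gauss_def has_bochner_integral_iff integrable_density integral_density
      del: integrable_mult_left_iff)

text \<open>Rescaling coordinate \<open>j\<close> by \<open>c j\<close> costs the Jacobian and
  changes the density by the displayed exponential factor. Positive scales produce the even moments;
  signs \<open>c j = - 1\<close> leave the density unchanged and produce the symmetries.\<close>

lemma has_bochner_integral_gauss_diagonal:
  fixes F :: "'a::euclidean_space \<Rightarrow> real" and c :: "'a \<Rightarrow> real"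
  defines "T u \<equiv> \<Sum>j\<in>Basis. (c j * (u \<bullet> j)) *\<^sub>R j"
  assumes c: "\<And>j. j \<in> Basis \<Longrightarrow> c j \<noteq> 0" and F: "has_bochner_integral gauss F I"
  shows "has_bochner_integral gauss
    (\<lambda>u. (\<Prod>j\<in>Basis. \<bar>c j\<bar>) * (exp (\<Sum>j\<in>Basis. (1 - (c j)\<^sup>2) * (u \<bullet> j)\<^sup>2) * F (T u))) I"
proof -
  have [measurable]: "F \<in> borel_measurable borel"
    using F by (auto dest: borel_measurable_has_bochner_integral)
  have T [measurable]: "T \<in> borel_measurable borel"
    unfolding T_def by measurable
  have "(norm (T u))\<^sup>2 = (norm u)\<^sup>2 - (\<Sum>j\<in>Basis. (1 - (c j)\<^sup>2) * (u \<bullet> j)\<^sup>2)" for u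
    by (simp add: T_def norm_power2_eq_sum_Basis sum_subtractf[symmetric] inner_sum_left inner_Basis
        if_distrib power_mult_distrib algebra_simps cong: if_cong)
  then have n: "exp (- (norm (T u))\<^sup>2) = exp (- (norm u)\<^sup>2) * exp (\<Sum>j\<in>Basis. (1 - (c j)\<^sup>2) * (u \<bullet> j)\<^sup>2)" for u
    by (simp add: exp_add[symmetric])
  from F have "has_bochner_integral lborel
      (\<lambda>u. pi powr (- real DIM('a) / 2) * exp (- (norm u)\<^sup>2) * F u) I"
    by (subst (asm) has_bochner_integral_gauss_iff) simp_all
  from has_bochner_integral_lborel_diagonal[OF _ this, of c] c
  have "has_bochner_integral lborel (\<lambda>u. (\<Prod>j\<in>Basis. \<bar>c j\<bar>) *
      (pi powr (- real DIM('a) / 2) * exp (- (norm (T u))\<^sup>2) * F (T u))) I"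
    by (simp add: T_def)
  then show ?thesis
    by (subst has_bochner_integral_gauss_iff) (simp_all add: n ac_simps)
qed

text \<open>Rescaling the coordinates in \<open>B\<close> by \<open>s > 0\<close> gives
  \<open>E (F u * exp ((1 - s\<^sup>2) * Q u)) = E (F u) / s ^ (card B + p)\<close>, where \<open>Q u\<close> is the sum of the
  squared coordinates in \<open>B\<close>. As \<open>exp y \<ge> 1 + y\<close>, the function
  \<open>s \<mapsto> E (F u) / s ^ (card B + p) - (1 - s\<^sup>2) * E (F u * Q u)\<close> is minimal at \<open>s = 1\<close>, and the
  vanishing of its derivative there is the claim.\<close>

lemma has_bochner_integral_gauss_homogeneous:
  fixes F :: "'a::euclidean_space \<Rightarrow> real" and p :: nat
  defines "S B s u \<equiv> \<Sum>j\<in>Basis. ((if j \<in> B then s else 1) * (u \<bullet> j)) *\<^sub>R j"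
  assumes B: "B \<subseteq> Basis" and nonneg: "\<And>u. F u \<ge> 0"
    and hom: "\<And>s u. s > 0 \<Longrightarrow> F (S B s u) = s ^ p * F u"
    and F: "has_bochner_integral gauss F I"
  shows "has_bochner_integral gauss (\<lambda>u. F u * (\<Sum>b\<in>B. (u \<bullet> b)\<^sup>2)) ((card B + p) / 2 * I)"
proof -
  define Q where "Q u = (\<Sum>b\<in>B. (u \<bullet> b)\<^sup>2)" for u :: 'a
  define n where "n = card B + p"
  have [measurable]: "F \<in> borel_measurable borel"
    using F by (auto dest: borel_measurable_has_bochner_integral)
  have [measurable]: "Q \<in> borel_measurable borel"
    unfolding Q_def by measurable
  have Q: "Q u \<ge> 0" for u
    by (simp add: Q_def sum_nonneg)
  have scaled: "has_bochner_integral gauss (\<lambda>u. F u * exp ((1 - s\<^sup>2) * Q u)) (I / s ^ n)"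
    if s: "s > 0" for s
  proof -
    let ?c = "\<lambda>j. if j \<in> B then s else 1"
    have pr: "(\<Prod>j\<in>Basis. \<bar>?c j\<bar>) = s ^ card B"
    proof -
      have "(\<Prod>j\<in>Basis. \<bar>?c j\<bar>) = (\<Prod>j\<in>Basis. if j \<in> B then s else 1)"
        using s by (intro prod.cong) auto
      also have "\<dots> = (\<Prod>j\<in>Basis \<inter> B. s)"
        by (subst prod.inter_restrict) auto
      finally show ?thesis
        using B by (simp add: Int_absorb1)
    qed
    have ex: "(\<Sum>j\<in>Basis. (1 - (?c j)\<^sup>2) * (u \<bullet> j)\<^sup>2) = (1 - s\<^sup>2) * Q u" for u
    proof -
      have "(\<Sum>j\<in>Basis. (1 - (?c j)\<^sup>2) * (u \<bullet> j)\<^sup>2) =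
          (\<Sum>j\<in>Basis. if j \<in> B then (1 - s\<^sup>2) * (u \<bullet> j)\<^sup>2 else 0)"
        by (intro sum.cong) auto
      also have "\<dots> = (\<Sum>j\<in>Basis \<inter> B. (1 - s\<^sup>2) * (u \<bullet> j)\<^sup>2)"
        by (subst sum.inter_restrict) auto
      finally show ?thesis
        using B by (simp add: Int_absorb1 Q_def sum_distrib_left)
    qed
    have "has_bochner_integral gauss
        (\<lambda>u. s ^ card B * (exp ((1 - s\<^sup>2) * Q u) * (s ^ p * F u))) I"
      using has_bochner_integral_gauss_diagonal[OF _ F, of ?c] s
      by (simp only: pr ex hom[unfolded S_def]) simp
    from has_bochner_integral_mult_right[OF this, of "1 / s ^ n"] s
    show ?thesis
      by (simp add: n_def power_add ac_simps)
  qed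
  have lin: "F u * (1 + y) \<le> F u * exp y" for u y
    by (intro mult_left_mono nonneg exp_ge_add_one_self)
  \<comment> \<open>The instance \<open>s = 1/2\<close> has weight \<open>exp (3/4 * Q u)\<close>,
    which exceeds \<open>3/4 * Q u\<close>; this is where the factor \<open>4/3\<close> of the
    dominating function comes from.\<close>
  have int: "integrable gauss (\<lambda>u. F u * Q u)"
  proof (rule Bochner_Integration.integrable_bound)
    show "integrable gauss (\<lambda>u. F u * exp ((1 - (1/2)\<^sup>2) * Q u) * (4/3))"
      using scaled[of "1/2"] by (intro integrable_mult_left) (simp add: has_bochner_integral_iff)
    show "AE u in gauss. norm (F u * Q u) \<le> norm (F u * exp ((1 - (1/2)\<^sup>2) * Q u) * (4/3))"
    proof (rule AE_I2)
      fix u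
      have "F u * (3/4 * Q u) \<le> F u * exp (3/4 * Q u)"
        using lin[of u "3/4 * Q u"] nonneg[of u] by (simp add: algebra_simps)
      then show "norm (F u * Q u) \<le> norm (F u * exp ((1 - (1/2)\<^sup>2) * Q u) * (4/3))"
        using nonneg[of u] Q[of u] by (simp add: power_divide)
    qed
  qed measurable
  define J where "J = (\<integral>u. F u * Q u \<partial>gauss)"
  define \<phi> where "\<phi> s = I / s ^ n - (1 - s\<^sup>2) * J" for s :: real
  have "- n * I + 2 * J = 0"
  proof (rule DERIV_local_min[of \<phi> _ 1 1])
    show "DERIV \<phi> 1 :> - n * I + 2 * J"
      unfolding \<phi>_def by (auto intro!: derivative_eq_intros)
    show "\<forall>s. \<bar>1 - s\<bar> < 1 \<longrightarrow> \<phi> 1 \<le> \<phi> s"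
    proof (intro allI impI)
      fix s :: real assume "\<bar>1 - s\<bar> < 1"
      then have s: "s > 0" by linarith
      have "I + (1 - s\<^sup>2) * J = (\<integral>u. F u + (1 - s\<^sup>2) * (F u * Q u) \<partial>gauss)"
        using F int by (simp add: J_def has_bochner_integral_iff)
      also have "\<dots> \<le> (\<integral>u. F u * exp ((1 - s\<^sup>2) * Q u) \<partial>gauss)"
      proof (rule integral_mono)
        show "F u + (1 - s\<^sup>2) * (F u * Q u) \<le> F u * exp ((1 - s\<^sup>2) * Q u)" for u
          using lin[of u "(1 - s\<^sup>2) * Q u"] by (simp add: distrib_left mult.left_commute)
      qed (use F int scaled[OF s] in \<open>auto simp: has_bochner_integral_iff\<close>)
      also have "\<dots> = I / s ^ n"
        using scaled[OF s] by (simp add: has_bochner_integral_iff)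
      finally show "\<phi> 1 \<le> \<phi> s"
        by (simp add: \<phi>_def)
    qed
  qed simp
  then have "J = (card B + p) / 2 * I"
    by (simp add: n_def algebra_simps)
  with int show ?thesis
    by (simp add: J_def has_bochner_integral_iff Q_def)
qed

text \<open>With \<open>B = Basis\<close> the diagonal map is multiplication by \<open>s\<close>.
  The result is a recursion: a factor \<open>(norm u)\<^sup>2\<close> on a nonnegative function of
  degree \<open>p\<close> multiplies its mean by \<open>(d + p) / 2\<close>.\<close>

lemma has_bochner_integral_gauss_times_norm2:
  fixes F :: "'a::euclidean_space \<Rightarrow> real" and p :: nat
  assumes "\<And>u. F u \<ge> 0" "\<And>s u. s > 0 \<Longrightarrow> F (s *\<^sub>R u) = s ^ p * F u"
    and "has_bochner_integral gauss F I"
  shows "has_bochner_integral gauss (\<lambda>u. F u * (norm u)\<^sup>2) ((real DIM('a) + p) / 2 * I)"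
proof -
  have "(\<Sum>j\<in>Basis. ((if j \<in> Basis then s else 1) * (u \<bullet> j)) *\<^sub>R j) = s *\<^sub>R u" for s and u :: 'a
    by (subst (2) euclidean_representation[symmetric]) (simp add: scaleR_sum_right)
  with has_bochner_integral_gauss_homogeneous[of Basis F p I] assms
  show ?thesis
    by (simp add: norm_power2_eq_sum_Basis)
qed

text \<open>The recursion starts at the constant 1, of degree 0. The next two moments follow from
  degrees 2 and 4.\<close>

lemma gauss_norm2:
  "has_bochner_integral gauss (\<lambda>u::'a::euclidean_space. (norm u)\<^sup>2) (real DIM('a) / 2)"
  using has_bochner_integral_gauss_times_norm2[of "\<lambda>_::'a. 1" 0 1]
  by (simp add: has_bochner_integral_iff gauss.prob_space[unfolded space_gauss])

lemma gauss_norm4: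
  "has_bochner_integral gauss (\<lambda>u::'a::euclidean_space. norm u ^ 4)
     (real DIM('a) * (real DIM('a) + 2) / 4)"
  using has_bochner_integral_gauss_times_norm2[OF _ _ gauss_norm2[where 'a='a], of 2]
  by (simp add: power_mult_distrib power_add[symmetric] algebra_simps)

lemma gauss_norm6:
  "has_bochner_integral gauss (\<lambda>u::'a::euclidean_space. norm u ^ 6)
     (real DIM('a) * (real DIM('a) + 2) * (real DIM('a) + 4) / 8)"
  using has_bochner_integral_gauss_times_norm2[OF _ _ gauss_norm4[where 'a='a], of 4]
  by (simp add: power_mult_distrib power_add[symmetric] field_simps)

lemma gauss_coordinate2:
  fixes b :: "'a::euclidean_space"
  assumes "b \<in> Basis"
  shows "has_bochner_integral gauss (\<lambda>u. (u \<bullet> b)\<^sup>2) (1 / 2)"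
  using has_bochner_integral_gauss_homogeneous[of "{b}" "\<lambda>_. 1" 0 1] assms
  by (simp add: has_bochner_integral_iff gauss.prob_space[unfolded space_gauss])

text \<open>Reflecting the coordinates in \<open>B\<close> preserves the Gaussian measure, so the
  integral equals its own negative.\<close>

lemma gauss_integral_odd:
  fixes F :: "'a::euclidean_space \<Rightarrow> real"
  assumes int: "integrable gauss F"
    and odd: "\<And>u. F (\<Sum>j\<in>Basis. ((if j \<in> B then - 1 else 1) * (u \<bullet> j)) *\<^sub>R j) = - F u"
  shows "(\<integral>u. F u \<partial>gauss) = 0"
proof -
  let ?c = "\<lambda>j. if j \<in> B then - 1 else 1 :: real"
  have "(\<Prod>j\<in>(Basis :: 'a set). \<bar>?c j\<bar>) = 1" "(\<Sum>j\<in>Basis. (1 - (?c j)\<^sup>2) * (u \<bullet> j)\<^sup>2) = 0" for u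
    by (auto intro!: prod.neutral sum.neutral)
  with has_bochner_integral_gauss_diagonal[OF _ has_bochner_integral_integrable[OF int], of ?c]
  have "has_bochner_integral gauss (\<lambda>u. - F u) (\<integral>u. F u \<partial>gauss)"
    by (simp only: odd) simp
  then have "(\<integral>u. - F u \<partial>gauss) = (\<integral>u. F u \<partial>gauss)"
    by (simp add: has_bochner_integral_iff)
  then show ?thesis by simp
qed

lemma integrable_gauss_power:
  assumes "p \<le> 6"
  shows "integrable gauss (\<lambda>u::'a::euclidean_space. norm u ^ p)"
proof (rule Bochner_Integration.integrable_bound)
  \<comment> \<open>The sixth moment is the highest one computed, whence the range of
    \<open>p\<close>; the summand 1 covers the unit ball.\<close>
  show "integrable gauss (\<lambda>u::'a. 1 + norm u ^ 6)"
    using gauss_norm6 by (auto simp: has_bochner_integral_iff)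
  show "AE u in gauss. norm (norm u ^ p) \<le> norm (1 + norm (u::'a) ^ 6)"
  proof (rule AE_I2)
    fix u :: 'a
    have "norm u ^ p \<le> 1 + norm u ^ 6"
    proof (cases "norm u \<le> 1")
      case True
      then show ?thesis
        by (smt (verit) norm_ge_zero power_le_one zero_le_power)
    next
      case False
      then have "norm u ^ p \<le> norm u ^ 6"
        using assms by (intro power_increasing) auto
      then show ?thesis by simp
    qed
    then show "norm (norm u ^ p) \<le> norm (1 + norm u ^ 6)"
      by simp
  qed
qed measurable

lemma integrable_gauss_bound:
  fixes F :: "'a::euclidean_space \<Rightarrow> 'b::{banach, second_countable_topology}"
  assumes "F \<in> borel_measurable borel" "p \<le> 6" "\<And>u. norm (F u) \<le> c * norm u ^ p"
  shows "integrable gauss F"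
proof (rule Bochner_Integration.integrable_bound)
  show "integrable gauss (\<lambda>u::'a. c * norm u ^ p)"
    using integrable_gauss_power[OF assms(2)] by (rule integrable_mult_right)
  show "AE u in gauss. norm (F u) \<le> norm (c * norm u ^ p)"
    using assms(3) order_trans[OF _ abs_ge_self] by auto
qed (use assms in measurable)

lemma gauss_inner:
  fixes a :: "'a::euclidean_space"
  shows "has_bochner_integral gauss (\<lambda>u. a \<bullet> u) 0"
proof -
  have int: "integrable gauss (\<lambda>u. a \<bullet> u)"
    by (rule integrable_gauss_bound[where p=1 and c="norm a"]) (auto simp: Cauchy_Schwarz_ineq2)
  have "a \<bullet> (\<Sum>j\<in>Basis. ((if j \<in> UNIV then - 1 else 1) * (u \<bullet> j)) *\<^sub>R j) = - (a \<bullet> u)" for u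
    by (simp add: sum_negf euclidean_representation)
  from gauss_integral_odd[OF int this] int show ?thesis
    by (simp add: has_bochner_integral_iff)
qed

text \<open>The covariance of \<open>gauss\<close> is half the identity: off-diagonal entries vanish
  by reflection, diagonal ones are 1/2. This factor is what the 2 in \<open>zo_delta\<close>
  compensates.\<close>

lemma gauss_inner_inner:
  fixes a v :: "'a::euclidean_space"
  shows "has_bochner_integral gauss (\<lambda>u. (a \<bullet> u) * (v \<bullet> u)) (a \<bullet> v / 2)"
proof -
  have offdiag: "has_bochner_integral gauss (\<lambda>u. (u \<bullet> b) * (u \<bullet> c)) 0"
    if "b \<in> Basis" "c \<in> Basis" "b \<noteq> c" for b c :: 'a
  proof -
    have int: "integrable gauss (\<lambda>u. (u \<bullet> b) * (u \<bullet> c))"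
      by (rule integrable_gauss_bound[where p=2 and c=1])
        (auto simp: abs_mult power2_eq_square that Basis_le_norm intro!: mult_mono)
    \<comment> \<open>Only coordinate \<open>b\<close> is reflected, so exactly one of the two
      factors changes sign.\<close>
    have "((\<Sum>j\<in>Basis. ((if j \<in> {b} then - 1 else 1) * (u \<bullet> j)) *\<^sub>R j) \<bullet> b) *
      ((\<Sum>j\<in>Basis. ((if j \<in> {b} then - 1 else 1) * (u \<bullet> j)) *\<^sub>R j) \<bullet> c) = - ((u \<bullet> b) * (u \<bullet> c))" for u
      using that by simp
    from gauss_integral_odd[OF int this] int show ?thesis
      by (simp add: has_bochner_integral_iff)
  qed
  have "has_bochner_integral gauss
      (\<lambda>u. \<Sum>b\<in>Basis. \<Sum>c\<in>Basis. ((a \<bullet> b) * (v \<bullet> c)) * ((u \<bullet> b) * (u \<bullet> c)))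
      (\<Sum>b\<in>Basis. \<Sum>c\<in>Basis. ((a \<bullet> b) * (v \<bullet> c)) * (if b = c then 1 / 2 else 0))"
    using offdiag gauss_coordinate2
    by (intro has_bochner_integral_sum has_bochner_integral_mult_right) (auto simp: power2_eq_square)
  moreover have "(\<Sum>b\<in>Basis. \<Sum>c\<in>Basis. ((a \<bullet> b) * (v \<bullet> c)) * ((u \<bullet> b) * (u \<bullet> c))) = (a \<bullet> u) * (v \<bullet> u)" for u
    unfolding euclidean_inner[of a u] euclidean_inner[of v u] sum_product by (simp add: ac_simps)
  moreover have "(\<Sum>b\<in>Basis. \<Sum>c\<in>Basis. ((a \<bullet> b) * (v \<bullet> c)) * (if b = c then 1 / 2 else 0)) = a \<bullet> v / 2"
    by (subst euclidean_inner) (simp add: if_distrib sum_divide_distrib cong: if_cong)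
  ultimately show ?thesis by simp
qed

text \<open>\<open>(a \<bullet> u)\<^sup>2\<close> is homogeneous of degree 2, so the radial
  recursion gives the exact value. Cauchy-Schwarz with the fourth moment would lose a factor
  \<open>d\<close>.\<close>

lemma gauss_inner2_norm2:
  fixes a :: "'a::euclidean_space"
  shows "has_bochner_integral gauss (\<lambda>u. (a \<bullet> u)\<^sup>2 * (norm u)\<^sup>2) ((real DIM('a) + 2) / 4 * (norm a)\<^sup>2)"
proof -
  have "has_bochner_integral gauss (\<lambda>u. (a \<bullet> u)\<^sup>2) ((norm a)\<^sup>2 / 2)"
    using gauss_inner_inner[of a a] unfolding power2_norm_eq_inner by (simp add: power2_eq_square)
  from has_bochner_integral_gauss_times_norm2[OF _ _ this, of 2] show ?thesis
    by (simp add: power_mult_distrib)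
qed

subsection \<open>The gradient estimator at a fixed point\<close>

lemma zo_delta_measurable [measurable (raw)]:
  assumes [measurable]: "f \<in> borel_measurable borel" "X \<in> borel_measurable M" "V \<in> borel_measurable M"
  shows "(\<lambda>w. zo_delta fwd f s (X w) (V w)) \<in> borel_measurable M"
  unfolding zo_delta_def by measurable

lemma zo_delta_taylor:
  fixes f :: "'a::euclidean_space \<Rightarrow> real"
  assumes "L_smooth f L" and s: "s > 0"
  shows "\<bar>zo_delta fwd f s x u - 2 * (grad f x \<bullet> u)\<bar> \<le> L * s * (norm u)\<^sup>2"
proof -
  have 1: "\<bar>f (x + s *\<^sub>R u) - f x - s * (grad f x \<bullet> u)\<bar> \<le> s * (L * s * (norm u)\<^sup>2 / 2)"
    using L_smooth_taylor[OF assms(1), of x "s *\<^sub>R u"] s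
    by (simp add: power_mult_distrib power2_eq_square ac_simps)
  have 2: "\<bar>f (x - s *\<^sub>R u) - f x + s * (grad f x \<bullet> u)\<bar> \<le> s * (L * s * (norm u)\<^sup>2 / 2)"
    using L_smooth_taylor[OF assms(1), of x "- s *\<^sub>R u"] s
    by (simp add: power_mult_distrib power2_eq_square ac_simps)
  \<comment> \<open>Clearing the denominator leaves Taylor remainders: the forward quotient yields
    twice one remainder, the central quotient the difference of two. Both choices therefore share
    one bound.\<close>
  have "\<bar>s * (zo_delta fwd f s x u - 2 * (grad f x \<bullet> u))\<bar> \<le> s * (L * s * (norm u)\<^sup>2)"
  proof (cases fwd)
    case True
    then have eq: "s * (zo_delta fwd f s x u - 2 * (grad f x \<bullet> u)) = 2 * (f (x + s *\<^sub>R u) - f x - s * (grad f x \<bullet> u))"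
      using s by (simp add: zo_delta_def field_simps)
    show ?thesis
      unfolding eq abs_mult using 1 by simp
  next
    case False
    then have "s * (zo_delta fwd f s x u - 2 * (grad f x \<bullet> u)) =
        (f (x + s *\<^sub>R u) - f x - s * (grad f x \<bullet> u)) - (f (x - s *\<^sub>R u) - f x + s * (grad f x \<bullet> u))"
      using s by (simp add: zo_delta_def field_simps)
    with 1 2 show ?thesis by linarith
  qed
  then show ?thesis
    using s by (simp add: abs_mult)
qed

lemma zo_estimator_second_moment:
  fixes f :: "'a::euclidean_space \<Rightarrow> real"
  assumes f: "L_smooth f L" and L: "L > 0" and s: "s > 0"
  shows "integrable gauss (\<lambda>u. (norm (zo_delta fwd f s x u *\<^sub>R u))\<^sup>2)" (is ?int)
    and "(\<integral>u. (norm (zo_delta fwd f s x u *\<^sub>R u))\<^sup>2 \<partial>gauss) \<le>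
      2 * (real DIM('a) + 4) * (norm (grad f x))\<^sup>2 + L\<^sup>2 * s\<^sup>2 * (real DIM('a) + 6) ^ 3 / 4" (is ?le)
proof -
  note [measurable] = L_smooth_measurable[OF f]
  define a where "a = grad f x"
  define d where "d = real DIM('a)"
  \<comment> \<open>Split \<open>zo_delta\<close> into \<open>2 * (a \<bullet> u)\<close> and the
    remainder \<open>r\<close>, and use that the square of a sum is at most twice the sum of
    squares. The coefficients are 2 * 4 = 8 for the linear part and 2 for the remainder.\<close>
  let ?g = "\<lambda>u. 8 * ((a \<bullet> u)\<^sup>2 * (norm u)\<^sup>2) + 2 * L\<^sup>2 * s\<^sup>2 * norm u ^ 6"
  have bound: "(norm (zo_delta fwd f s x u *\<^sub>R u))\<^sup>2 \<le> ?g u" for u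
  proof -
    define r where "r = zo_delta fwd f s x u - 2 * (a \<bullet> u)"
    have "r\<^sup>2 \<le> (L * s * (norm u)\<^sup>2)\<^sup>2"
      using zo_delta_taylor[OF f s] by (intro abs_le_square_iff[THEN iffD1]) (smt (verit) a_def r_def)
    moreover have "(zo_delta fwd f s x u)\<^sup>2 \<le> 2 * (2 * (a \<bullet> u))\<^sup>2 + 2 * r\<^sup>2"
      using sum_squares_bound[of "2 * (a \<bullet> u)" r] by (simp add: r_def power2_eq_square algebra_simps)
    ultimately have "(zo_delta fwd f s x u)\<^sup>2 \<le> 8 * (a \<bullet> u)\<^sup>2 + 2 * (L * s * (norm u)\<^sup>2)\<^sup>2"
      by (simp add: power_mult_distrib)
    then have "(zo_delta fwd f s x u)\<^sup>2 * (norm u)\<^sup>2 \<le> (8 * (a \<bullet> u)\<^sup>2 + 2 * (L * s * (norm u)\<^sup>2)\<^sup>2) * (norm u)\<^sup>2"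
      by (intro mult_right_mono) simp_all
    then show ?thesis
      by (simp add: power_mult_distrib algebra_simps power_add[symmetric] flip: power_mult)
  qed
  have g: "has_bochner_integral gauss ?g
      (8 * ((d + 2) / 4 * (norm a)\<^sup>2) + 2 * L\<^sup>2 * s\<^sup>2 * (d * (d + 2) * (d + 4) / 8))"
    unfolding d_def by (intro has_bochner_integral_add has_bochner_integral_mult_right
        gauss_inner2_norm2 gauss_norm6)
  show int: ?int
    by (rule Bochner_Integration.integrable_bound[where f="?g"])
      (use g bound in \<open>auto simp: has_bochner_integral_iff intro: order_trans[OF _ abs_ge_self]\<close>)
  have "(\<integral>u. (norm (zo_delta fwd f s x u *\<^sub>R u))\<^sup>2 \<partial>gauss) \<le> (\<integral>u. ?g u \<partial>gauss)"
    using g by (intro integral_mono int bound) (simp add: has_bochner_integral_iff)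
  also have "\<dots> = 2 * (d + 2) * (norm a)\<^sup>2 + L\<^sup>2 * s\<^sup>2 * (d * (d + 2) * (d + 4)) / 4"
    unfolding has_bochner_integral_integral_eq[OF g] by (simp add: field_simps)
  \<comment> \<open>The moments give sharper constants; they are relaxed to the shape that the final
    bound has.\<close>
  also have "\<dots> \<le> 2 * (d + 4) * (norm a)\<^sup>2 + L\<^sup>2 * s\<^sup>2 * (d + 6) ^ 3 / 4"
  proof -
    have "d * (d + 2) * (d + 4) \<le> (d + 6) ^ 3"
      unfolding power3_eq_cube d_def by (intro mult_mono) auto
    then show ?thesis
      by (intro add_mono mult_right_mono divide_right_mono mult_left_mono) auto
  qed
  finally show ?le
    by (simp add: a_def d_def)
qed

lemma integrable_if_square_integrable:
  fixes F :: "'a \<Rightarrow> 'b::{banach, second_countable_topology}"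
  assumes "finite_measure M" "F \<in> borel_measurable M" "integrable M (\<lambda>x. (norm (F x))\<^sup>2)"
  shows "integrable M F"
proof (rule Bochner_Integration.integrable_bound)
  show "integrable M (\<lambda>x. 1 + (norm (F x))\<^sup>2)"
    using assms by (auto simp: finite_measure.integrable_const)
  show "AE x in M. norm (F x) \<le> norm (1 + (norm (F x))\<^sup>2)"
  proof (rule AE_I2)
    fix x
    have "norm (F x) \<le> 1 + (norm (F x))\<^sup>2"
      using sum_squares_bound[of "norm (F x)" 1] norm_ge_zero[of "F x"]
      by (simp only: mult_1_right power_one)
    then show "norm (F x) \<le> norm (1 + (norm (F x))\<^sup>2)"
      by simp
  qed
qed (use assms in simp)

text \<open>The linear part \<open>2 * (a \<bullet> u)\<close> times \<open>u\<close> has mean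
  exactly \<open>a\<close>, so the bias \<open>w\<close> comes from the remainder alone. Testing
  against \<open>w\<close> itself expresses its squared norm as the mean of
  \<open>r u * (w \<bullet> u)\<close>.\<close>

lemma zo_estimator_bias:
  fixes f :: "'a::euclidean_space \<Rightarrow> real"
  assumes f: "L_smooth f L" and L: "L > 0" and s: "s > 0"
  shows "(norm ((\<integral>u. zo_delta fwd f s x u *\<^sub>R u \<partial>gauss) - grad f x))\<^sup>2 \<le>
      L\<^sup>2 * s\<^sup>2 * (real DIM('a) * (real DIM('a) + 2)) / 8"
proof -
  note [measurable] = L_smooth_measurable[OF f]
  define a where "a = grad f x"
  define m where "m = (\<integral>u. zo_delta fwd f s x u *\<^sub>R u \<partial>gauss)"
  define w where "w = m - a"
  define d where "d = real DIM('a)"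
  define r where "r u = zo_delta fwd f s x u - 2 * (a \<bullet> u)" for u
  have [measurable]: "r \<in> borel_measurable borel"
    unfolding r_def by measurable
  have r: "\<bar>r u\<bar> \<le> L * s * (norm u)\<^sup>2" for u
    using zo_delta_taylor[OF f s] by (simp add: a_def r_def)
  have int: "integrable gauss (\<lambda>u. zo_delta fwd f s x u *\<^sub>R u)"
    by (rule integrable_if_square_integrable)
      (use zo_estimator_second_moment(1)[OF f L s] in \<open>simp_all add: gauss.finite_measure_axioms\<close>)
  have aw: "has_bochner_integral gauss (\<lambda>u. 2 * ((a \<bullet> u) * (w \<bullet> u))) (a \<bullet> w)"
    using has_bochner_integral_mult_right[OF gauss_inner_inner[of a w], of 2] by simp
  \<comment> \<open>Young's inequality, weighted so that the part quadratic in \<open>w\<close> has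
    mean \<open>w \<bullet> w / 2\<close>. Half of the left-hand side absorbs it, and doubling the
    other part turns 1/16 into 1/8.\<close>
  let ?g = "\<lambda>u. L * s * (L * s / 4 * norm u ^ 4 + (1 / (L * s)) * ((w \<bullet> u) * (w \<bullet> u)))"
  have g: "has_bochner_integral gauss ?g (L * s * (L * s / 4 * (d * (d + 2) / 4) + (1 / (L * s)) * (w \<bullet> w / 2)))"
    unfolding d_def by (intro has_bochner_integral_add has_bochner_integral_mult_right
        gauss_inner_inner gauss_norm4)
  have young: "r u * (w \<bullet> u) \<le> ?g u" for u
  proof -
    have "(norm u)\<^sup>2 * \<bar>w \<bullet> u\<bar> \<le> L * s / 4 * norm u ^ 4 + (1 / (L * s)) * ((w \<bullet> u) * (w \<bullet> u))"
    proof -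
      have "0 \<le> (L * s * (norm u)\<^sup>2 / 2 - \<bar>w \<bullet> u\<bar>)\<^sup>2 / (L * s)"
        using L s by simp
      also have "\<dots> = L * s / 4 * norm u ^ 4 + (1 / (L * s)) * ((w \<bullet> u) * (w \<bullet> u)) - (norm u)\<^sup>2 * \<bar>w \<bullet> u\<bar>"
        using L s by (simp add: power2_diff power_mult_distrib power_divide power2_eq_square[of L]
            power2_eq_square[of s] field_simps flip: power_mult) (simp add: power2_eq_square)
      finally show ?thesis by simp
    qed
    then have "L * s * ((norm u)\<^sup>2 * \<bar>w \<bullet> u\<bar>) \<le> ?g u"
      using L s by (intro mult_left_mono) auto
    moreover have "r u * (w \<bullet> u) \<le> (L * s * (norm u)\<^sup>2) * \<bar>w \<bullet> u\<bar>"
      using mult_right_mono[OF r[of u], of "\<bar>w \<bullet> u\<bar>"] by (simp flip: abs_mult)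
    ultimately show ?thesis by (simp add: mult.assoc)
  qed
  have "w \<bullet> w = w \<bullet> m - a \<bullet> w"
    by (simp add: w_def inner_diff_left inner_diff_right inner_commute)
  also have "w \<bullet> m = (\<integral>u. w \<bullet> (zo_delta fwd f s x u *\<^sub>R u) \<partial>gauss)"
    unfolding m_def using int by (rule integral_inner_right[symmetric])
  also have "\<dots> - a \<bullet> w = (\<integral>u. w \<bullet> (zo_delta fwd f s x u *\<^sub>R u) - 2 * ((a \<bullet> u) * (w \<bullet> u)) \<partial>gauss)"
    unfolding has_bochner_integral_integral_eq[OF aw, symmetric]
    by (intro Bochner_Integration.integral_diff[symmetric] integrable_inner_right int integrable.intros[OF aw])
  also have "\<dots> = (\<integral>u. r u * (w \<bullet> u) \<partial>gauss)"
    by (simp add: r_def algebra_simps)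
  also have "\<dots> \<le> (\<integral>u. ?g u \<partial>gauss)"
  proof (rule integral_mono)
    show "integrable gauss (\<lambda>u. r u * (w \<bullet> u))"
    proof (rule integrable_gauss_bound[where p=3 and c="L * s * norm w"])
      fix u
      have "\<bar>r u\<bar> * \<bar>w \<bullet> u\<bar> \<le> (L * s * (norm u)\<^sup>2) * (norm w * norm u)"
        using L s by (intro mult_mono r Cauchy_Schwarz_ineq2) auto
      then show "norm (r u * (w \<bullet> u)) \<le> L * s * norm w * norm u ^ 3"
        by (simp add: abs_mult power2_eq_square power3_eq_cube ac_simps)
    qed auto
  qed (use g young in \<open>auto simp: has_bochner_integral_iff\<close>)
  also have "\<dots> = L\<^sup>2 * s\<^sup>2 * (d * (d + 2)) / 16 + w \<bullet> w / 2"
    using g L s by (simp add: has_bochner_integral_iff field_simps power2_eq_square)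
  finally show ?thesis
    by (simp add: w_def m_def a_def d_def power2_norm_eq_inner)
qed

section \<open>Second moment of an average of independent samples\<close>

lemma (in prob_space) norm2_average_iid:
  fixes V :: "nat \<Rightarrow> 'a \<Rightarrow> 'b::euclidean_space" and H :: "'b \<Rightarrow> 'c::euclidean_space"
  assumes ind: "indep_vars (\<lambda>_. borel) V {1..N}" and N: "N \<ge> 1"
    and distr: "\<And>n. n \<in> {1..N} \<Longrightarrow> distr M borel (V n) = \<mu>"
    and [measurable]: "H \<in> borel_measurable borel" and sq: "integrable \<mu> (\<lambda>u. (norm (H u))\<^sup>2)"
  shows "has_bochner_integral M (\<lambda>w. (norm ((1 / real N) *\<^sub>R (\<Sum>n = 1..N. H (V n w))))\<^sup>2)
    (1 / N * (\<integral>u. (norm (H u))\<^sup>2 \<partial>\<mu>) + (1 - 1 / N) * (norm (\<integral>u. H u \<partial>\<mu>))\<^sup>2)"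
proof -
  define G where "G = (\<integral>u. (norm (H u))\<^sup>2 \<partial>\<mu>)"
  define m where "m = (\<integral>u. H u \<partial>\<mu>)"
  have V [measurable]: "random_variable borel (V n)" if "n \<in> {1..N}" for n
    using ind that by (auto simp: indep_vars_def)
  have sqV: "integrable M (\<lambda>w. (norm (H (V n w)))\<^sup>2)" "(\<integral>w. (norm (H (V n w)))\<^sup>2 \<partial>M) = G"
    if n: "n \<in> {1..N}" for n
    using sq n unfolding G_def distr[OF n, symmetric]
    by (auto simp: integrable_distr_eq integral_distr)
  have intV: "integrable M (\<lambda>w. H (V n w))" if n: "n \<in> {1..N}" for n
    by (rule integrable_if_square_integrable) (use sqV n in \<open>auto simp: finite_measure_axioms\<close>)
  have mV: "(\<integral>w. H (V n w) \<partial>M) = m" if n: "n \<in> {1..N}" for n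
    unfolding m_def distr[OF n, symmetric] using n by (simp add: integral_distr)
  have cross: "has_bochner_integral M (\<lambda>w. H (V n w) \<bullet> H (V k w)) (if n = k then G else m \<bullet> m)"
    if n: "n \<in> {1..N}" and k: "k \<in> {1..N}" for n k
  proof (cases "n = k")
    case True
    then show ?thesis
      using sqV[OF n] by (simp add: has_bochner_integral_iff power2_norm_eq_inner)
  next
    case False
    \<comment> \<open>Independence factors the mean of a product of real variables, so the inner
      product is treated coordinate by coordinate.\<close>
    have "has_bochner_integral M (\<lambda>w. (H (V n w) \<bullet> b) * (H (V k w) \<bullet> b)) ((m \<bullet> b) * (m \<bullet> b))" for b
    proof -
      have "indep_var borel ((\<lambda>v. H (v n) \<bullet> b) \<circ> (\<lambda>w. restrict (\<lambda>i. V i w) {n}))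
          borel ((\<lambda>v. H (v k) \<bullet> b) \<circ> (\<lambda>w. restrict (\<lambda>i. V i w) {k}))"
        using False n k by (intro indep_var_compose[OF indep_var_restrict[OF ind]]) auto
      then have iv: "indep_var borel (\<lambda>w. H (V n w) \<bullet> b) borel (\<lambda>w. H (V k w) \<bullet> b)"
        by (simp add: comp_def)
      show ?thesis
        using indep_var_lebesgue_integral[OF iv] indep_var_integrable[OF iv] intV mV n k
        by (simp add: has_bochner_integral_iff)
    qed
    then have "has_bochner_integral M (\<lambda>w. \<Sum>b\<in>Basis. (H (V n w) \<bullet> b) * (H (V k w) \<bullet> b))
        (\<Sum>b\<in>Basis. (m \<bullet> b) * (m \<bullet> b))"
      by (intro has_bochner_integral_sum)
    then show ?thesis
      using False by (simp flip: euclidean_inner)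
  qed
  \<comment> \<open>Expanding the square gives N diagonal terms of mean \<open>G\<close> and N (N -
    1) mixed terms of mean \<open>m \<bullet> m\<close>.\<close>
  have "has_bochner_integral M (\<lambda>w. 1 / (real N)\<^sup>2 * (\<Sum>n = 1..N. \<Sum>k = 1..N. H (V n w) \<bullet> H (V k w)))
      (1 / (real N)\<^sup>2 * (\<Sum>n = 1..N. \<Sum>k = 1..N. if n = k then G else m \<bullet> m))"
    by (intro has_bochner_integral_mult_right has_bochner_integral_sum cross)
  moreover have "(norm ((1 / real N) *\<^sub>R (\<Sum>n = 1..N. H (V n w))))\<^sup>2 =
      1 / (real N)\<^sup>2 * (\<Sum>n = 1..N. \<Sum>k = 1..N. H (V n w) \<bullet> H (V k w))" for w
    by (simp add: power_divide power2_norm_eq_inner[of "sum _ _"] inner_sum_left inner_sum_right)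
      (subst sum.swap, simp)
  moreover have "1 / (real N)\<^sup>2 * (\<Sum>n = 1..N. \<Sum>k = 1..N. if n = k then G else m \<bullet> m) =
      1 / N * G + (1 - 1 / N) * (m \<bullet> m)"
  proof -
    have "(\<Sum>k = 1..N. if n = k then G else m \<bullet> m) = G + (real N - 1) * (m \<bullet> m)" if "n \<in> {1..N}" for n
    proof -
      have "(\<Sum>k = 1..N. if n = k then G else m \<bullet> m) = (\<Sum>k = 1..N. m \<bullet> m + (if n = k then G - m \<bullet> m else 0))"
        by (intro sum.cong) auto
      also have "\<dots> = real N * (m \<bullet> m) + (G - m \<bullet> m)"
        using that by (simp add: sum.distrib)
      finally show ?thesis by (simp add: algebra_simps)
    qed
    then have "(\<Sum>n = 1..N. \<Sum>k = 1..N. if n = k then G else m \<bullet> m) = real N * (G + (real N - 1) * (m \<bullet> m))"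
      by simp
    then show ?thesis
      using N by (simp only:) (simp add: power2_eq_square field_simps)
  qed
  ultimately show ?thesis
    by (simp add: G_def m_def power2_norm_eq_inner[of "\<integral>u. H u \<partial>\<mu>"])
qed

subsection \<open>One step of the method\<close>

lemma zo_grad_measurable [measurable (raw)]:
  assumes [measurable]: "f \<in> borel_measurable borel" "X \<in> borel_measurable M"
    and V: "\<And>n. n \<in> {1..N} \<Longrightarrow> (\<lambda>w. V w n) \<in> borel_measurable M"
  shows "(\<lambda>w. zo_grad fwd f s N (X w) (V w)) \<in> borel_measurable M"
  unfolding zo_grad_def
  by (intro borel_measurable_scaleR borel_measurable_const borel_measurable_sum zo_delta_measurable V assms)

text \<open>Lets the allowance \<open>L * d / t\<close> pay for the bias and one copy of the noise.
  After division by \<open>L\<^sup>2\<close> only \<open>l = L * t\<close> remains, and the step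
  size bound places \<open>2 * d * (d + 4)\<close> between the two sides.\<close>

lemma zo_step_constants:
  fixes d L t N :: real
  assumes L: "L > 0" and t: "t > 0" "t < 1 / (2 * L * (d + 4))" and d: "d \<ge> 1" and N: "N \<ge> 1"
  shows "L ^ 3 * t * (d + 6) ^ 3 / (4 * N) + L\<^sup>2 * (d * (d + 2)) / 4 \<le> L * d / t"
proof -
  define l where "l = L * t"
  have "t * (2 * L * (d + 4)) < 1"
    using t(2) L d by (subst (asm) pos_less_divide_eq) auto
  then have l1: "l * (2 * (d + 4)) \<le> 1" and l: "l > 0" "l < 1 / (2 * (d + 4))"
    using L t d by (simp_all add: l_def pos_less_divide_eq ac_simps)
  have "l * (d + 6) ^ 3 / (4 * N) \<le> l * (d + 6) ^ 3 / 4"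
    using l d N by (intro divide_left_mono) auto
  also have "\<dots> \<le> 1 / (2 * (d + 4)) * (d + 6) ^ 3 / 4"
    using l d by (intro divide_right_mono mult_right_mono) auto
  also have "\<dots> \<le> 2 * d * (d + 4) - d * (d + 2) / 4"
  proof -
    \<comment> \<open>The difference of the two sides of the next cubic inequality, divided by
      \<open>d - 1\<close> with remainder 27.\<close>
    have "0 \<le> (d - 1) * (13 * d\<^sup>2 + 111 * d + 243) + 27"
      using d by (intro add_nonneg_nonneg mult_nonneg_nonneg) auto
    then have "(d + 6) ^ 3 \<le> (2 * d * (d + 4) - d * (d + 2) / 4) * (8 * (d + 4))"
      by (simp add: power3_eq_cube power2_eq_square field_simps)
    then show ?thesis
      using d by (simp add: field_simps)
  qed
  finally have "l * (d + 6) ^ 3 / (4 * N) + d * (d + 2) / 4 \<le> 2 * d * (d + 4)"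
    by simp
  also have "\<dots> \<le> d / l"
  proof -
    have "2 * d * (d + 4) * l = d * (l * (2 * (d + 4)))"
      by simp
    also have "\<dots> \<le> d * 1"
      using d by (intro mult_left_mono[OF l1]) simp
    finally show ?thesis
      by (simp add: pos_le_divide_eq[OF l(1)])
  qed
  finally have "L\<^sup>2 * (l * (d + 6) ^ 3 / (4 * N) + d * (d + 2) / 4) \<le> L\<^sup>2 * (d / l)"
    by (intro mult_left_mono) auto
  then show ?thesis
    using L t by (simp add: l_def field_simps power2_eq_square power3_eq_cube)
qed

text \<open>To be read with \<open>a\<close> the gradient and \<open>m\<close> the estimator mean:
  \<open>A\<close>, \<open>m2\<close> and \<open>D\<close> are the squared norms of
  \<open>a\<close>, \<open>m\<close> and \<open>m - a\<close>, \<open>am\<close> is their inner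
  product, and \<open>G\<close> is the second moment of one sample.\<close>

lemma zo_step_arith:
  fixes d L t N s A m2 am D G :: real
  assumes L: "L > 0" and t: "t > 0" "t < 1 / (2 * L * (d + 4))" and d: "d \<ge> 1" and N: "N \<ge> 1"
    and nonneg: "A \<ge> 0" "m2 \<ge> 0"
    and D: "D \<le> L\<^sup>2 * s\<^sup>2 * (d * (d + 2)) / 8" and am: "2 * am = A + m2 - D"
    and G: "G \<le> 2 * (d + 4) * A + L\<^sup>2 * s\<^sup>2 * (d + 6) ^ 3 / 4"
  shows "- t * am + L * t\<^sup>2 / 2 * (1 / N * G + (1 - 1 / N) * m2) \<le>
    - (t / 4 * (1 - 2 * L * t * (d + 4) / N) * A)
    + t / 4 * (L ^ 3 * t * (d + 6) ^ 3 / (4 * N) + L * d / t) * s\<^sup>2"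
proof -
  define C where "C = L ^ 3 * t * (d + 6) ^ 3 / (4 * N)"
  define \<kappa> where "\<kappa> = L * t * (d + 4) / N"
  have lt: "L * t * (d + 4) < 1 / 2"
    using t(2) L d by (subst (asm) pos_less_divide_eq) (auto simp: ac_simps)
  have \<kappa>: "\<kappa> \<le> 1 / 2"
  proof -
    have "\<kappa> \<le> L * t * (d + 4) / 1"
      unfolding \<kappa>_def using L t d N by (intro divide_left_mono) auto
    with lt show ?thesis by simp
  qed
  have "L * t * 1 \<le> L * t * (d + 4)"
    using L t d by (intro mult_left_mono) auto
  with lt have Lt: "L * t \<le> 1" by simp
  have "L * t\<^sup>2 / 2 * ((1 - 1 / N) * m2) = t / 2 * (L * t * (1 - 1 / N)) * m2"
    by (simp add: power2_eq_square)
  also have "\<dots> \<le> t / 2 * 1 * m2"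
  proof (intro mult_right_mono mult_left_mono)
    show "L * t * (1 - 1 / N) \<le> 1"
      using N by (intro mult_le_one[OF Lt]) simp_all
  qed (use t nonneg in simp_all)
  finally have 1: "L * t\<^sup>2 / 2 * ((1 - 1 / N) * m2) \<le> t / 2 * m2" by simp
  \<comment> \<open>The noise amounts to two copies of \<open>C\<close>. One stays in the bound; the
    other is absorbed together with the bias.\<close>
  have "L * t\<^sup>2 / 2 * (1 / N * G) \<le> L * t\<^sup>2 / 2 * (1 / N * (2 * (d + 4) * A + L\<^sup>2 * s\<^sup>2 * (d + 6) ^ 3 / 4))"
    using L N by (intro mult_left_mono G) auto
  also have "\<dots> = t * \<kappa> * A + t / 4 * (2 * C) * s\<^sup>2"
    using N by (simp add: C_def \<kappa>_def field_simps power2_eq_square power3_eq_cube)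
  finally have 2: "L * t\<^sup>2 / 2 * (1 / N * G) \<le> t * \<kappa> * A + t / 4 * (2 * C) * s\<^sup>2" .
  have "- t * am = - t / 2 * (2 * am)"
    by simp
  also have "\<dots> = - t / 2 * A - t / 2 * m2 + t / 2 * D"
    unfolding am by (simp add: field_simps)
  finally have "- t * am = - t / 2 * A - t / 2 * m2 + t / 2 * D" .
  moreover have "t / 2 * D \<le> t / 2 * (L\<^sup>2 * s\<^sup>2 * (d * (d + 2)) / 8)"
    using t by (intro mult_left_mono D) auto
  ultimately have 3: "- t * am \<le> - t / 2 * A - t / 2 * m2 + t / 4 * (L\<^sup>2 * (d * (d + 2)) / 4) * s\<^sup>2"
    by (simp add: algebra_simps)
  have "t / 4 * (2 * C + L\<^sup>2 * (d * (d + 2)) / 4) * s\<^sup>2 \<le> t / 4 * (C + L * d / t) * s\<^sup>2"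
    using zo_step_constants[OF L t d N, folded C_def] t
    by (intro mult_right_mono mult_left_mono) auto
  then have 4: "t / 4 * (2 * C) * s\<^sup>2 + t / 4 * (L\<^sup>2 * (d * (d + 2)) / 4) * s\<^sup>2 \<le> t / 4 * (C + L * d / t) * s\<^sup>2"
    by (simp only: distrib_left distrib_right)
  \<comment> \<open>The net coefficient of \<open>A\<close> is exactly
    \<open>- t / 2 * (1 - 2 * \<kappa>)\<close>. As \<open>\<kappa> \<le> 1 / 2\<close>, half of
    this decrease can be given up, which leaves the factor \<open>t / 4\<close>.\<close>
  have "t * \<kappa> * A \<le> t * (1 / 4 + \<kappa> / 2) * A"
    using \<kappa> t nonneg by (intro mult_right_mono mult_left_mono) auto
  then have 5: "t * \<kappa> * A - t / 2 * A \<le> - (t / 4 * (1 - 2 * \<kappa>) * A)"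
    by (simp add: algebra_simps)
  have \<kappa>2: "2 * L * t * (d + 4) / N = 2 * \<kappa>"
    by (simp add: \<kappa>_def)
  show ?thesis
    using 1 2 3 4 5 unfolding C_def[symmetric] \<kappa>2 distrib_left[of "L * t\<^sup>2 / 2"] by linarith
qed

lemma (in prob_space) zo_step_expectation:
  fixes f :: "'b::euclidean_space \<Rightarrow> real" and V :: "nat \<Rightarrow> 'a \<Rightarrow> 'b"
  defines "d \<equiv> real DIM('b)"
  assumes f: "L_smooth f L" and L: "L > 0" and s: "s > 0" and N: "N \<ge> 1"
    and t: "0 < t" "t < 1 / (2 * L * (d + 4))"
    and ind: "indep_vars (\<lambda>_. borel) V {1..N}"
    and distr: "\<And>n. n \<in> {1..N} \<Longrightarrow> distr M borel (V n) = gauss"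
  shows "integrable M (\<lambda>w. f (x - t *\<^sub>R zo_grad fwd f s N x (\<lambda>n. V n w)))" (is ?int)
    and "expectation (\<lambda>w. f (x - t *\<^sub>R zo_grad fwd f s N x (\<lambda>n. V n w))) \<le>
      f x - t / 4 * (1 - 2 * L * t * (d + 4) / N) * (norm (grad f x))\<^sup>2
      + t / 4 * (L ^ 3 * t * (d + 6) ^ 3 / (4 * real N) + L * d / t) * s\<^sup>2" (is ?le)
proof -
  note [measurable] = L_smooth_measurable[OF f]
  define a where "a = grad f x"
  define H where "H u = zo_delta fwd f s x u *\<^sub>R u" for u
  define g where "g w = zo_grad fwd f s N x (\<lambda>n. V n w)" for w
  define m where "m = (\<integral>u. H u \<partial>gauss)"
  define G where "G = (\<integral>u. (norm (H u))\<^sup>2 \<partial>gauss)"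
  have [measurable]: "H \<in> borel_measurable borel"
    unfolding H_def by measurable
  have V [measurable]: "random_variable borel (V n)" if "n \<in> {1..N}" for n
    using ind that by (auto simp: indep_vars_def)
  have [measurable]: "random_variable borel g"
    unfolding g_def by (intro zo_grad_measurable V) auto
  note second = zo_estimator_second_moment[OF f L s, of fwd x, folded H_def]
  have intH: "integrable gauss H"
    by (rule integrable_if_square_integrable) (use second(1) in \<open>simp_all add: gauss.finite_measure_axioms\<close>)
  have g_eq: "g w = (1 / real N) *\<^sub>R (\<Sum>n = 1..N. H (V n w))" for w
    by (simp add: g_def zo_grad_def H_def)
  have g2: "has_bochner_integral M (\<lambda>w. (norm (g w))\<^sup>2) (1 / N * G + (1 - 1 / N) * (norm m)\<^sup>2)"
    unfolding g_eq G_def m_def by (rule norm2_average_iid[OF ind N distr]) (use second(1) in auto)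
  have intV: "integrable M (\<lambda>w. H (V n w))" "(\<integral>w. H (V n w) \<partial>M) = m" if n: "n \<in> {1..N}" for n
    using intH n unfolding m_def distr[OF n, symmetric] by (auto simp: integrable_distr_eq integral_distr)
  have "has_bochner_integral M g ((1 / real N) *\<^sub>R (\<Sum>n = 1..N. m))"
    unfolding g_eq using intV
    by (intro has_bochner_integral_scaleR_right has_bochner_integral_sum) (auto simp: has_bochner_integral_iff)
  then have g1: "has_bochner_integral M g m"
    using N by (simp add: sum_constant_scaleR)
  have taylor: "\<bar>f (x - t *\<^sub>R g w) - f x + t * (a \<bullet> g w)\<bar> \<le> L * t\<^sup>2 / 2 * (norm (g w))\<^sup>2" for w
    using L_smooth_taylor[OF f, of x "- t *\<^sub>R g w"] by (simp add: a_def power_mult_distrib)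
  have upper: "has_bochner_integral M (\<lambda>w. f x - t * (a \<bullet> g w) + L * t\<^sup>2 / 2 * (norm (g w))\<^sup>2)
      (f x - t * (a \<bullet> m) + L * t\<^sup>2 / 2 * (1 / N * G + (1 - 1 / N) * (norm m)\<^sup>2))"
    using prob_space by (intro has_bochner_integral_add has_bochner_integral_diff has_bochner_integral_mult_right
        has_bochner_integral_inner_right g1 g2) (simp add: has_bochner_integral_iff)
  \<comment> \<open>The upper bound alone does not control \<open>f\<close> from below; the
    two-sided Taylor estimate dominates its absolute value.\<close>
  have int: "integrable M (\<lambda>w. f (x - t *\<^sub>R g w))"
  proof (rule Bochner_Integration.integrable_bound)
    show "integrable M (\<lambda>w. \<bar>f x - t * (a \<bullet> g w)\<bar> + L * t\<^sup>2 / 2 * (norm (g w))\<^sup>2)"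
      using g1 g2 by (intro Bochner_Integration.integrable_add integrable_abs Bochner_Integration.integrable_diff
          integrable_mult_right integrable_inner_right) (auto simp: has_bochner_integral_iff)
    show "AE w in M. norm (f (x - t *\<^sub>R g w)) \<le> norm (\<bar>f x - t * (a \<bullet> g w)\<bar> + L * t\<^sup>2 / 2 * (norm (g w))\<^sup>2)"
      using taylor by (intro AE_I2) (smt (verit) real_norm_def)
  qed measurable
  then show ?int by (simp add: g_def)
  have "expectation (\<lambda>w. f (x - t *\<^sub>R g w)) \<le> expectation (\<lambda>w. f x - t * (a \<bullet> g w) + L * t\<^sup>2 / 2 * (norm (g w))\<^sup>2)"
  proof (intro integral_mono int)
    show "f (x - t *\<^sub>R g w) \<le> f x - t * (a \<bullet> g w) + L * t\<^sup>2 / 2 * (norm (g w))\<^sup>2" for w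
      using taylor[of w] by linarith
  qed (rule integrable.intros[OF upper])
  also have "\<dots> = f x + (- t * (a \<bullet> m) + L * t\<^sup>2 / 2 * (1 / N * G + (1 - 1 / N) * (norm m)\<^sup>2))"
    using upper by (simp add: has_bochner_integral_iff)
  also have "- t * (a \<bullet> m) + L * t\<^sup>2 / 2 * (1 / N * G + (1 - 1 / N) * (norm m)\<^sup>2) \<le>
    - (t / 4 * (1 - 2 * L * t * (d + 4) / N) * (norm a)\<^sup>2)
    + t / 4 * (L ^ 3 * t * (d + 6) ^ 3 / (4 * real N) + L * d / t) * s\<^sup>2"
  proof (rule zo_step_arith[where D="(norm (m - a))\<^sup>2"])
    show "2 * (a \<bullet> m) = (norm a)\<^sup>2 + (norm m)\<^sup>2 - (norm (m - a))\<^sup>2"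
      by (simp add: power2_norm_eq_inner inner_diff_left inner_diff_right inner_commute)
  qed (use L t N second(2) zo_estimator_bias[OF f L s, of fwd x] in
      \<open>auto simp: d_def a_def m_def G_def H_def DIM_positive Suc_leI\<close>)
  finally show ?le by (simp add: g_def a_def)
qed

subsection \<open>The iteration\<close>

text \<open>The iterate \<open>k\<close> reads only samples with first index below \<open>k\<close>.
  It is thus a function of a block of samples that is independent of those of the next step.\<close>

lemma zo_iter_cong:
  assumes "\<And>j n. j < k \<Longrightarrow> n \<in> {1..N} \<Longrightarrow> u j n = v j n"
  shows "zo_iter fwd f \<sigma> N t x0 u k = zo_iter fwd f \<sigma> N t x0 v k"
  using assms
proof (induction k)
  case (Suc k)
  then have "zo_iter fwd f \<sigma> N t x0 u k = zo_iter fwd f \<sigma> N t x0 v k"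
    by simp
  moreover have "zo_grad fwd f s N x (u k) = zo_grad fwd f s N x (v k)" for s x
    using Suc.prems by (simp add: zo_grad_def)
  ultimately show ?case by simp
qed simp

lemma zo_iter_measurable:
  assumes [measurable]: "f \<in> borel_measurable borel"
    and "\<And>j n. j < k \<Longrightarrow> n \<in> {1..N} \<Longrightarrow> (\<lambda>w. u w j n) \<in> borel_measurable M"
  shows "(\<lambda>w. zo_iter fwd f \<sigma> N t x0 (u w) k) \<in> borel_measurable M"
  using assms(2)
proof (induction k)
  case (Suc k)
  then show ?case
    by (auto intro!: borel_measurable_diff borel_measurable_scaleR zo_grad_measurable)
qed simp

text \<open>Past and fresh samples have a product law, so the one-step bound at a fixed point is
  integrated over the law of the current iterate. This is conditioning, carried out with Tonelli's
  theorem.\<close>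

lemma (in prob_space) zo_iter_descent:
  fixes f :: "'b::euclidean_space \<Rightarrow> real" and U :: "nat \<times> nat \<Rightarrow> 'a \<Rightarrow> 'b"
    and N k :: nat and \<sigma> :: "nat \<Rightarrow> real" and fwd :: bool and x0 :: 'b and L t c :: real
  defines "d \<equiv> real DIM('b)"
    and "X i w \<equiv> zo_iter fwd f \<sigma> N t x0 (\<lambda>j n. U (j, n) w) i"
  defines "\<alpha> \<equiv> t / 4 * (1 - 2 * L * t * (d + 4) / N)"
    and "\<beta> \<equiv> t / 4 * (L ^ 3 * t * (d + 6) ^ 3 / (4 * real N) + L * d / t)"
  assumes f: "L_smooth f L" and L: "L > 0" and s: "\<sigma> (Suc k) > 0" and N: "N \<ge> 1"
    and t: "0 < t" "t < 1 / (2 * L * (d + 4))" and \<alpha>: "\<alpha> > 0"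
    and bdd: "\<And>x. c \<le> f x"
    and ind: "indep_vars (\<lambda>_. borel) U (UNIV \<times> {1..N})"
    and distr: "\<And>i. i \<in> UNIV \<times> {1..N} \<Longrightarrow> distr M borel (U i) = gauss"
    and int: "integrable M (\<lambda>w. f (X k w))"
  shows "integrable M (\<lambda>w. f (X (Suc k) w))" (is ?thesis1)
    and "integrable M (\<lambda>w. (norm (grad f (X k w)))\<^sup>2)" (is ?thesis2)
    and "expectation (\<lambda>w. f (X (Suc k) w)) + \<alpha> * expectation (\<lambda>w. (norm (grad f (X k w)))\<^sup>2) \<le>
      expectation (\<lambda>w. f (X k w)) + \<beta> * (\<sigma> (Suc k))\<^sup>2" (is ?thesis3)
proof -
  note f_meas [measurable] = L_smooth_measurable[OF f]
  note [measurable] = L_smooth_grad_measurable[OF f L]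
  define s where "s = \<sigma> (Suc k)"
  \<comment> \<open>Computing iterate \<open>Suc k\<close> consumes the samples with first index
    \<open>k\<close>, while the radius has index \<open>Suc k\<close>.\<close>
  define J where "J = {k} \<times> {1..N}"
  define R where "R w = (\<lambda>i\<in>J. U i w)" for w
  have U [measurable]: "random_variable borel (U (j, n))" if "n \<in> {1..N}" for j n
    using ind that by (auto simp: indep_vars_def)
  have X [measurable]: "random_variable borel (X k)" for k
    unfolding X_def by (intro zo_iter_measurable) (auto intro: U)
  have \<beta>: "\<beta> \<ge> 0"
    using L t by (simp add: \<beta>_def d_def)
  define K where "K = {..<k} \<times> {1..N}"
  define Q where "Q w = (\<lambda>i\<in>K. U i w)" for w
  define Y where "Y y = zo_iter fwd f \<sigma> N t x0 (\<lambda>j n. y (j, n)) k" for y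
  have Y [measurable]: "Y \<in> borel_measurable (PiM K (\<lambda>_. borel))"
    unfolding Y_def by (intro zo_iter_measurable) (auto simp: K_def)
  have XY: "X k w = Y (Q w)" for w
    unfolding X_def Y_def by (rule zo_iter_cong) (auto simp: Q_def K_def)
  have iv: "indep_var (PiM K (\<lambda>_. borel)) Q (PiM J (\<lambda>_. borel)) R"
    unfolding Q_def[abs_def] R_def[abs_def] by (rule indep_var_restrict[OF ind]) (auto simp: K_def J_def)
  then have Q [measurable]: "random_variable (PiM K (\<lambda>_. borel)) Q"
    and R [measurable]: "random_variable (PiM J (\<lambda>_. borel)) R"
    by (auto dest: indep_var_rv1 indep_var_rv2)
  have indV: "indep_vars (\<lambda>_. borel) (\<lambda>n. U (k, n)) {1..N}"
  proof -
    have "indep_vars (\<lambda>n. PiM {(k, n)} (\<lambda>_. borel)) (\<lambda>n w. \<lambda>i\<in>{(k, n)}. U i w) {1..N}"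
      by (rule indep_vars_restrict[OF ind]) (auto simp: disjoint_family_on_def)
    from indep_vars_compose2[OF this, of "\<lambda>n v. v (k, n)" "\<lambda>_. borel"] show ?thesis
      by simp
  qed
  define g where "g x v = zo_grad fwd f s N x (\<lambda>n. v (k, n))" for x and v :: "nat \<times> nat \<Rightarrow> 'b"
  have gR: "g x (R w) = zo_grad fwd f s N x (\<lambda>n. U (k, n) w)" for x w
    by (simp add: g_def R_def J_def zo_grad_def)
  \<comment> \<open>Subtracting the lower bound \<open>c\<close> makes the integrand nonnegative, so
    integrals can be exchanged before integrability of the new iterate is known.\<close>
  define \<Phi> where "\<Phi> x v = ennreal (f (x - t *\<^sub>R g x v) - c)" for x v
  have [measurable]: "case_prod g \<in> borel_measurable (borel \<Otimes>\<^sub>M PiM J (\<lambda>_. borel))"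
    unfolding g_def split_beta' by (intro zo_grad_measurable f_meas measurable_fst) (auto simp: J_def)
  have [measurable]: "case_prod \<Phi> \<in> borel_measurable (borel \<Otimes>\<^sub>M PiM J (\<lambda>_. borel))"
    unfolding \<Phi>_def split_beta' by measurable
  \<comment> \<open>The gradient term stands on the left so that every quantity is nonnegative and
    the inequality makes sense in \<open>ennreal\<close>.\<close>
  have step: "(\<integral>\<^sup>+v. \<Phi> x v \<partial>distr M (PiM J (\<lambda>_. borel)) R) + ennreal (\<alpha> * (norm (grad f x))\<^sup>2)
      \<le> ennreal (f x - c + \<beta> * s\<^sup>2)" for x
  proof -
    have V: "distr M borel (U (k, n)) = gauss" if "n \<in> {1..N}" for n
      using distr that by simp
    note st = zo_step_expectation[where x=x and fwd=fwd, OF f L s N t[unfolded d_def] indV V]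
    have 1: "integrable M (\<lambda>w. f (x - t *\<^sub>R g x (R w)))"
      unfolding gR s_def by (rule st(1))
    have 2: "expectation (\<lambda>w. f (x - t *\<^sub>R g x (R w))) \<le> f x - \<alpha> * (norm (grad f x))\<^sup>2 + \<beta> * s\<^sup>2"
      unfolding gR s_def \<alpha>_def \<beta>_def d_def by (rule st(2))
    have "(\<integral>\<^sup>+v. \<Phi> x v \<partial>distr M (PiM J (\<lambda>_. borel)) R) = (\<integral>\<^sup>+w. \<Phi> x (R w) \<partial>M)"
      by (rule nn_integral_distr) measurable
    also have "\<dots> = ennreal (expectation (\<lambda>w. f (x - t *\<^sub>R g x (R w)) - c))"
      unfolding \<Phi>_def by (rule nn_integral_eq_integral) (use 1 bdd in auto)
    also have "\<dots> = ennreal (expectation (\<lambda>w. f (x - t *\<^sub>R g x (R w))) - c)"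
      using 1 by (simp add: prob_space)
    also have "\<dots> + ennreal (\<alpha> * (norm (grad f x))\<^sup>2) =
        ennreal (expectation (\<lambda>w. f (x - t *\<^sub>R g x (R w))) - c + \<alpha> * (norm (grad f x))\<^sup>2)"
    proof (rule ennreal_plus[symmetric])
      have "c \<le> expectation (\<lambda>w. f (x - t *\<^sub>R g x (R w)))"
        using 1 bdd by (intro integral_ge_const) auto
      then show "0 \<le> expectation (\<lambda>w. f (x - t *\<^sub>R g x (R w))) - c" by simp
    qed (use \<alpha> in simp)
    also have "\<dots> \<le> ennreal (f x - c + \<beta> * s\<^sup>2)"
      using 2 by (intro ennreal_leI) auto
    finally show ?thesis .
  qed
  interpret R: prob_space "distr M (PiM J (\<lambda>_. borel)) R"
    by (rule prob_space_distr) measurable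
  let ?\<nu> = "distr M (PiM K (\<lambda>_. borel)) Q"
  let ?\<rho> = "distr M (PiM J (\<lambda>_. borel)) R"
  have prod: "distr M (PiM K (\<lambda>_. borel) \<Otimes>\<^sub>M PiM J (\<lambda>_. borel)) (\<lambda>w. (Q w, R w)) = ?\<nu> \<Otimes>\<^sub>M ?\<rho>"
    using iv by (simp add: indep_var_distribution_eq)
  have "X (Suc k) w = X k w - t *\<^sub>R g (X k w) (R w)" for w
    by (simp add: X_def gR s_def)
  then have "(\<integral>\<^sup>+w. ennreal (f (X (Suc k) w) - c) \<partial>M) = (\<integral>\<^sup>+w. (\<lambda>(y, v). \<Phi> (Y y) v) (Q w, R w) \<partial>M)"
    by (simp add: \<Phi>_def XY)
  also have "\<dots> = (\<integral>\<^sup>+p. (\<lambda>(y, v). \<Phi> (Y y) v) p \<partial>(?\<nu> \<Otimes>\<^sub>M ?\<rho>))"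
    unfolding prod[symmetric] by (rule nn_integral_distr[symmetric]) measurable
  also have "\<dots> = (\<integral>\<^sup>+y. \<integral>\<^sup>+v. \<Phi> (Y y) v \<partial>?\<rho> \<partial>?\<nu>)"
    by (subst R.nn_integral_fst[symmetric]) auto
  finally have "(\<integral>\<^sup>+w. ennreal (f (X (Suc k) w) - c) \<partial>M) + (\<integral>\<^sup>+w. ennreal (\<alpha> * (norm (grad f (X k w)))\<^sup>2) \<partial>M)
      = (\<integral>\<^sup>+y. (\<integral>\<^sup>+v. \<Phi> (Y y) v \<partial>?\<rho>) + ennreal (\<alpha> * (norm (grad f (Y y)))\<^sup>2) \<partial>?\<nu>)"
    by (subst nn_integral_add) (auto simp: nn_integral_distr XY)
  also have "\<dots> \<le> (\<integral>\<^sup>+y. ennreal (f (Y y) - c + \<beta> * s\<^sup>2) \<partial>?\<nu>)"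
    by (intro nn_integral_mono step)
  also have "\<dots> = (\<integral>\<^sup>+w. ennreal (f (X k w) - c + \<beta> * s\<^sup>2) \<partial>M)"
    unfolding XY by (rule nn_integral_distr) measurable
  also have "\<dots> = ennreal (expectation (\<lambda>w. f (X k w) - c + \<beta> * s\<^sup>2))"
    using \<beta> bdd int by (intro nn_integral_eq_integral) (auto intro!: add_nonneg_nonneg)
  also have "expectation (\<lambda>w. f (X k w) - c + \<beta> * s\<^sup>2) = expectation (\<lambda>w. f (X k w)) - c + \<beta> * s\<^sup>2"
    using int by (simp add: prob_space)
  finally have total: "(\<integral>\<^sup>+w. ennreal (f (X (Suc k) w) - c) \<partial>M) + (\<integral>\<^sup>+w. ennreal (\<alpha> * (norm (grad f (X k w)))\<^sup>2) \<partial>M)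
      \<le> ennreal (expectation (\<lambda>w. f (X k w)) - c + \<beta> * s\<^sup>2)" .
  \<comment> \<open>The right-hand side is finite, so both integrals on the left are; this yields
    the integrability that carries the induction forward.\<close>
  from le_less_trans[OF this ennreal_less_top] have fin: "(\<integral>\<^sup>+w. ennreal (f (X (Suc k) w) - c) \<partial>M) < \<infinity>"
    "(\<integral>\<^sup>+w. ennreal (\<alpha> * (norm (grad f (X k w)))\<^sup>2) \<partial>M) < \<infinity>"
    by (simp_all add: less_top[symmetric])
  have int1: "integrable M (\<lambda>w. f (X (Suc k) w) - c)"
    by (rule integrableI_nonneg) (use fin bdd in auto)
  then have "integrable M (\<lambda>w. (f (X (Suc k) w) - c) + c)"
    by (intro Bochner_Integration.integrable_add) auto
  then show int1': ?thesis1 by simp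
  have int2: "integrable M (\<lambda>w. \<alpha> * (norm (grad f (X k w)))\<^sup>2)"
    by (rule integrableI_nonneg) (use fin \<alpha> in auto)
  then show ?thesis2
    using \<alpha> by simp
  have "ennreal (expectation (\<lambda>w. f (X (Suc k) w) - c) + expectation (\<lambda>w. \<alpha> * (norm (grad f (X k w)))\<^sup>2))
      \<le> ennreal (expectation (\<lambda>w. f (X k w)) - c + \<beta> * s\<^sup>2)"
    using total int1 int2 bdd \<alpha>
    by (simp add: nn_integral_eq_integral ennreal_plus integral_nonneg_AE)
  moreover have "0 \<le> expectation (\<lambda>w. f (X k w)) - c + \<beta> * s\<^sup>2"
    using integral_ge_const[OF int, of c] bdd \<beta> by simp
  ultimately show ?thesis3
    using int1' by (simp add: ennreal_le_iff prob_space s_def)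
qed

section \<open>Comparison of the function with its Gaussian smoothing\<close>

lemma gsmooth_eq_gauss:
  fixes f :: "'a::euclidean_space \<Rightarrow> real"
  assumes [measurable]: "f \<in> borel_measurable borel" and "s \<noteq> 0"
  shows "gsmooth f s x = (\<integral>u. f (x + s *\<^sub>R u) \<partial>gauss)"
  using assms(2) unfolding gsmooth_def gauss_def
  by (subst integral_density) (auto simp: mult.assoc mult.commute[of "f _"])

lemma gsmooth_measurable:
  fixes f :: "'a::euclidean_space \<Rightarrow> real"
  assumes [measurable]: "f \<in> borel_measurable borel" and "s \<noteq> 0"
  shows "gsmooth f s \<in> borel_measurable borel"
  unfolding gsmooth_eq_gauss[OF assms, abs_def] by measurable

lemma L_smooth_integrable_gauss:
  fixes f :: "'a::euclidean_space \<Rightarrow> real"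
  assumes f: "L_smooth f L"
  shows "integrable gauss (\<lambda>u. f (x + s *\<^sub>R u))"
proof (rule Bochner_Integration.integrable_bound)
  note [measurable] = L_smooth_measurable[OF f]
  let ?g = "\<lambda>u. \<bar>f x + s * (grad f x \<bullet> u)\<bar> + L / 2 * s\<^sup>2 * (norm u)\<^sup>2"
  show "integrable gauss ?g"
    using gauss_inner[of "grad f x"] gauss_norm2[where 'a='a]
    by (intro Bochner_Integration.integrable_add integrable_abs integrable_mult_right)
      (auto simp: has_bochner_integral_iff)
  have "\<bar>f (x + s *\<^sub>R u)\<bar> \<le> ?g u" for u
    using L_smooth_taylor[OF f, of x "s *\<^sub>R u"]
    unfolding inner_scaleR_right norm_scaleR power_mult_distrib power2_abs mult.assoc by linarith
  then show "AE u in gauss. norm (f (x + s *\<^sub>R u)) \<le> norm (?g u)"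
    by (intro AE_I2) (smt (verit) real_norm_def)
  show "(\<lambda>u. f (x + s *\<^sub>R u)) \<in> borel_measurable gauss"
    by measurable
qed

text \<open>Averaging the quadratic upper bound kills the linear term, and the mean
  \<open>d / 2\<close> of \<open>(norm u)\<^sup>2\<close> turns \<open>L / 2\<close> into
  \<open>L * d / 4\<close>.\<close>

lemma gsmooth_upper:
  fixes f :: "'a::euclidean_space \<Rightarrow> real"
  assumes f: "L_smooth f L" and s: "s \<noteq> 0"
  shows "gsmooth f s x \<le> f x + L * real DIM('a) / 4 * s\<^sup>2"
proof -
  have g: "has_bochner_integral gauss (\<lambda>u. f x + s * (grad f x \<bullet> u) + L / 2 * s\<^sup>2 * (norm u)\<^sup>2)
      (f x + s * 0 + L / 2 * s\<^sup>2 * (real DIM('a) / 2))"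
    using gauss.prob_space[where 'a='a]
    by (intro has_bochner_integral_add has_bochner_integral_mult_right gauss_inner gauss_norm2)
      (simp add: has_bochner_integral_iff)
  have "gsmooth f s x = (\<integral>u. f (x + s *\<^sub>R u) \<partial>gauss)"
    by (rule gsmooth_eq_gauss[OF L_smooth_measurable[OF f] s])
  also have "\<dots> \<le> (\<integral>u. f x + s * (grad f x \<bullet> u) + L / 2 * s\<^sup>2 * (norm u)\<^sup>2 \<partial>gauss)"
  proof (intro integral_mono L_smooth_integrable_gauss[OF f] integrable.intros[OF g])
    show "f (x + s *\<^sub>R u) \<le> f x + s * (grad f x \<bullet> u) + L / 2 * s\<^sup>2 * (norm u)\<^sup>2" for u
      using L_smooth_taylor_upper[OF f, of x "s *\<^sub>R u"] by (simp add: power_mult_distrib)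
  qed
  finally show ?thesis
    unfolding has_bochner_integral_integral_eq[OF g] by (simp add: field_simps)
qed

lemma gsmooth_lower:
  fixes f :: "'a::euclidean_space \<Rightarrow> real"
  assumes f: "L_smooth f L" and s: "s \<noteq> 0" and "\<And>x. c \<le> f x"
  shows "c \<le> gsmooth f s x"
  unfolding gsmooth_eq_gauss[OF L_smooth_measurable[OF f] s]
  using assms(3) by (intro gauss.integral_ge_const L_smooth_integrable_gauss[OF f]) auto

section \<open>Telescoping the expected decrease\<close>

theorem theorem4p2:
  fixes f :: "'a::euclidean_space \<Rightarrow> real"
    and M :: "'w measure"
    and U :: "nat \<times> nat \<Rightarrow> 'w \<Rightarrow> 'a"
    and \<sigma> :: "nat \<Rightarrow> real"
    and N k :: nat and L t :: real and x0 :: 'a and fwd :: bool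
  assumes "prob_space M"
    and "L > 0" and "L_smooth f L"
    and "\<exists>c. \<forall>x. c \<le> f x"
    and "\<forall>n\<ge>1. \<sigma> n > 0"
    and "N \<ge> 1"
    and "0 < t" and "t < 1 / (2 * L * (real DIM('a) + 4))"
    and "prob_space.indep_vars M (\<lambda>_. borel) U (UNIV \<times> {1..N})"
    and "\<forall>i\<in>UNIV \<times> {1..N}. distr M borel (U i) = gauss"
    and "k \<ge> 1"
  shows "Min ((\<lambda>i. prob_space.expectation M
                 (\<lambda>\<omega>. (norm (grad f (zo_iter fwd f \<sigma> N t x0 (\<lambda>j n. U (j, n) \<omega>) i)))\<^sup>2)) ` {..<k})
    \<le> 1 / real k * (real N / (real N - 2 * L * t * (real DIM('a) + 4))) *
       (4 * (f x0 - prob_space.expectation M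
                 (\<lambda>\<omega>. gsmooth f (\<sigma> k) (zo_iter fwd f \<sigma> N t x0 (\<lambda>j n. U (j, n) \<omega>) k))) / t
        + (L ^ 3 * t * (real DIM('a) + 6) ^ 3 / (4 * real N) + 2 * L * real DIM('a) / t)
          * (\<Sum>i = 1..k. (\<sigma> i)\<^sup>2))"
proof -
  interpret prob_space M by fact
  note f = assms(3) and L = assms(2) and N = assms(6) and t = assms(7,8) and ind = assms(9)
  obtain c where bdd: "\<And>x. c \<le> f x"
    using assms(4) by auto
  note [measurable] = L_smooth_measurable[OF f]
  define d where "d = real DIM('a)"
  define X where "X i \<omega> = zo_iter fwd f \<sigma> N t x0 (\<lambda>j n. U (j, n) \<omega>) i" for i \<omega>
  define E where "E i = expectation (\<lambda>\<omega>. (norm (grad f (X i \<omega>)))\<^sup>2)" for i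
  define \<gamma> where "\<gamma> = 1 - 2 * L * t * (d + 4) / N"
  define C where "C = L ^ 3 * t * (d + 6) ^ 3 / (4 * real N)"
  define S where "S n = (\<Sum>i = 1..n. (\<sigma> i)\<^sup>2)" for n
  \<comment> \<open>The step size bound gives \<open>2 * L * t * (d + 4) < 1\<close>, and 1 is at
    most \<open>N\<close>.\<close>
  have \<gamma>: "\<gamma> > 0"
  proof -
    have "t * (2 * L * (d + 4)) < 1"
      using t(2) L unfolding d_def by (subst (asm) pos_less_divide_eq) auto
    also have "1 \<le> real N" using N by simp
    finally show ?thesis
      using N by (simp add: \<gamma>_def field_simps)
  qed
  have X [measurable]: "random_variable borel (X i)" for i
    unfolding X_def using ind by (intro zo_iter_measurable) (auto simp: indep_vars_def)
  have desc: "integrable M (\<lambda>\<omega>. f (X (Suc i) \<omega>))"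
    "expectation (\<lambda>\<omega>. f (X (Suc i) \<omega>)) + t / 4 * \<gamma> * E i \<le>
      expectation (\<lambda>\<omega>. f (X i \<omega>)) + t / 4 * (C + L * d / t) * (\<sigma> (Suc i))\<^sup>2"
    if "integrable M (\<lambda>\<omega>. f (X i \<omega>))" for i
    using zo_iter_descent(1,3)[of f L \<sigma> i N t c U fwd x0] f L N t ind bdd that \<gamma> assms(5,10)
    by (auto simp: d_def X_def E_def \<gamma>_def C_def)
  have int: "integrable M (\<lambda>\<omega>. f (X i \<omega>))" for i
    by (induction i) (auto intro: desc(1), simp add: X_def)
  have total: "expectation (\<lambda>\<omega>. f (X n \<omega>)) + t / 4 * \<gamma> * (\<Sum>i<n. E i) \<le>
      f x0 + t / 4 * (C + L * d / t) * S n" for n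
  proof (induction n)
    case 0
    then show ?case by (simp add: X_def prob_space S_def)
  next
    case (Suc n)
    then show ?case
      using desc(2)[OF int[of n]] by (simp add: S_def distrib_left)
  qed
  have s: "\<sigma> k > 0"
    using assms(5,11) by simp
  have [measurable]: "gsmooth f (\<sigma> k) \<in> borel_measurable borel"
    using s by (intro gsmooth_measurable) auto
  have up: "gsmooth f (\<sigma> k) x \<le> f x + L * d / 4 * (\<sigma> k)\<^sup>2" for x
    using gsmooth_upper[OF f, of "\<sigma> k" x] s by (simp add: d_def)
  have low: "c \<le> gsmooth f (\<sigma> k) x" for x
    using gsmooth_lower[OF f _ bdd, of "\<sigma> k" x] s by simp
  have int_up: "integrable M (\<lambda>\<omega>. f (X k \<omega>) + L * d / 4 * (\<sigma> k)\<^sup>2)"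
    using int by auto
  \<comment> \<open>The smoothing lies between \<open>c\<close> and a constant shift of
    \<open>f\<close>, both integrable along the last iterate.\<close>
  have ints: "integrable M (\<lambda>\<omega>. gsmooth f (\<sigma> k) (X k \<omega>))"
  proof (rule Bochner_Integration.integrable_bound)
    show "integrable M (\<lambda>\<omega>. \<bar>c\<bar> + \<bar>f (X k \<omega>) + L * d / 4 * (\<sigma> k)\<^sup>2\<bar>)"
      using int_up by auto
    show "AE \<omega> in M. norm (gsmooth f (\<sigma> k) (X k \<omega>)) \<le> norm (\<bar>c\<bar> + \<bar>f (X k \<omega>) + L * d / 4 * (\<sigma> k)\<^sup>2\<bar>)"
    proof (rule AE_I2)
      fix \<omega>
      show "norm (gsmooth f (\<sigma> k) (X k \<omega>)) \<le> norm (\<bar>c\<bar> + \<bar>f (X k \<omega>) + L * d / 4 * (\<sigma> k)\<^sup>2\<bar>)"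
        using up[of "X k \<omega>"] low[of "X k \<omega>"] unfolding real_norm_def by linarith
    qed
    show "(\<lambda>\<omega>. gsmooth f (\<sigma> k) (X k \<omega>)) \<in> borel_measurable M"
      by measurable
  qed
  define P where "P = expectation (\<lambda>\<omega>. gsmooth f (\<sigma> k) (X k \<omega>))"
  have "P \<le> expectation (\<lambda>\<omega>. f (X k \<omega>) + L * d / 4 * (\<sigma> k)\<^sup>2)"
    unfolding P_def by (intro integral_mono ints int_up up)
  also have "\<dots> = expectation (\<lambda>\<omega>. f (X k \<omega>)) + L * d / 4 * (\<sigma> k)\<^sup>2"
    using int by (simp add: prob_space)
  \<comment> \<open>The only smoothing error is that of the last iterate; one term of the sum covers
    it.\<close>
  also have "(\<sigma> k)\<^sup>2 \<le> S k"
    unfolding S_def using assms(11) by (intro member_le_sum) auto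
  finally have "P \<le> expectation (\<lambda>\<omega>. f (X k \<omega>)) + L * d / 4 * S k"
    using L by (simp add: d_def mult_left_mono)
  with total[of k] have "t / 4 * \<gamma> * (\<Sum>i<k. E i) \<le> f x0 - P + t / 4 * (C + L * d / t) * S k + L * d / 4 * S k"
    by linarith
  then have "4 / t * (t / 4 * \<gamma> * (\<Sum>i<k. E i)) \<le> 4 / t * (f x0 - P + t / 4 * (C + L * d / t) * S k + L * d / 4 * S k)"
    using t by (intro mult_left_mono) auto
  \<comment> \<open>One \<open>L * d / t\<close> comes from the steps, the other from the smoothing
    error \<open>L * d / 4\<close> multiplied by \<open>4 / t\<close>.\<close>
  then have sum: "\<gamma> * (\<Sum>i<k. E i) \<le> 4 * (f x0 - P) / t + (C + 2 * L * d / t) * S k"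
    using t by (simp add: field_simps)
  have "real k * Min (E ` {..<k}) \<le> (\<Sum>i<k. E i)"
    using sum_bounded_below[of "{..<k}" "Min (E ` {..<k})" E] by simp
  then have "\<gamma> * (real k * Min (E ` {..<k})) \<le> 4 * (f x0 - P) / t + (C + 2 * L * d / t) * S k"
    using sum \<gamma> by (meson mult_left_mono order_trans less_imp_le)
  then have "Min (E ` {..<k}) \<le> 1 / real k * (1 / \<gamma>) * (4 * (f x0 - P) / t + (C + 2 * L * d / t) * S k)"
    using \<gamma> assms(11) by (simp add: pos_le_divide_eq ac_simps)
  moreover have "1 / \<gamma> = real N / (real N - 2 * L * t * (d + 4))"
    using N by (simp add: \<gamma>_def field_simps)
  ultimately show ?thesis
    by (simp add: E_def[abs_def] P_def X_def S_def C_def d_def)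
qed

end
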